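(* Let $b$ be a (possibly degenerate) alternating bilinear form on an $n$-dimensional vector space $V$ over a field of characteristic different from $2$, with Witt index $\nu$ and rank $r$. Let $\mathcal{V}$ be a linear subspace of $\mathcal{A}_b$ consisting only of nilpotent endomorphisms, with $\dim\mathcal{V}=\binom{n-r}{2}+r(n-r)+(\nu-n+r)(n-\nu-1)$. Then there exists a maximal partially complete $b$-singular flag $\mathcal{F}=(F_0,\dots,F_\nu)$ of $V$ such that $F_{n-r}=\mathrm{Rad}(b)$ and $\mathcal{V}$ equals the set of all nilpotent $b$-alternating endomorphisms of $V$ that stabilize $\mathcal{F}$.
   Context: $\mathrm{Rad}(b)=\{y\in V:\forall x\in V,\ b(x,y)=0\}$. The Witt index of $b$ is the maximal dimension of a totally singular subspace $X$ ($b(x,y)=0$ for all $x,y\in X$). An endomorphism $u$ is $b$-alternating if $(x,y)\mapsto b(x,u(y))$ is alternating (vanishes on all $(x,x)$); $\mathcal{A}_b$ is the space of these. A flag $(F_0,\dots,F_p)$ is an increasing sequence of subspaces; it is partially complete if $\dim F_i=i$ for all $i$, $b$-singular if $F_p$ is totally singular, and maximal if moreover $p$ is the Witt index of $b$. $u$ stabilizes the flag if $u(F_i)\subseteq F_i$ for all $i$. *)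

theory Defs
  imports Complex_Main "HOL-Library.Function_Algebras"
begin

text \<open>Ambient setting: a vector space over the field 'k with scalar multiplication
  scale on the type 'v (the whole type is the space V). Endomorphisms are functions
  'v => 'v; they form a vector space under pointwise operations with scalar
  multiplication fun_scale.\<close>

definition fun_scale :: "('k \<Rightarrow> 'v \<Rightarrow> 'v) \<Rightarrow> 'k \<Rightarrow> ('v \<Rightarrow> 'v) \<Rightarrow> ('v \<Rightarrow> 'v)" where
  "fun_scale scale c f = (\<lambda>x. scale c (f x))"

definition bilinear_form ::
  "('k::field \<Rightarrow> 'v::ab_group_add \<Rightarrow> 'v) \<Rightarrow> ('v \<Rightarrow> 'v \<Rightarrow> 'k) \<Rightarrow> bool" where
  "bilinear_form scale b \<longleftrightarrow>
     (\<forall>x. Vector_Spaces.linear scale (*) (b x)) \<and>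
     (\<forall>y. Vector_Spaces.linear scale (*) (\<lambda>x. b x y))"

definition alternating_form :: "('v \<Rightarrow> 'v \<Rightarrow> 'k::zero) \<Rightarrow> bool" where
  "alternating_form b \<longleftrightarrow> (\<forall>x. b x x = 0)"

definition Rad :: "('v \<Rightarrow> 'v \<Rightarrow> 'k::zero) \<Rightarrow> 'v set" where
  "Rad b = {y. \<forall>x. b x y = 0}"

definition totally_singular :: "('v \<Rightarrow> 'v \<Rightarrow> 'k::zero) \<Rightarrow> 'v set \<Rightarrow> bool" where
  "totally_singular b X \<longleftrightarrow> (\<forall>x\<in>X. \<forall>y\<in>X. b x y = 0)"

definition witt_index ::
  "('k::field \<Rightarrow> 'v::ab_group_add \<Rightarrow> 'v) \<Rightarrow> ('v \<Rightarrow> 'v \<Rightarrow> 'k) \<Rightarrow> nat" where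
  "witt_index scale b =
     Max {vector_space.dim scale X | X. module.subspace scale X \<and> totally_singular b X}"

definition form_rank ::
  "('k::field \<Rightarrow> 'v::ab_group_add \<Rightarrow> 'v) \<Rightarrow> ('v \<Rightarrow> 'v \<Rightarrow> 'k) \<Rightarrow> nat" where
  "form_rank scale b = vector_space.dim scale (UNIV::'v set) - vector_space.dim scale (Rad b)"

definition b_alternating ::
  "('k::field \<Rightarrow> 'v::ab_group_add \<Rightarrow> 'v) \<Rightarrow> ('v \<Rightarrow> 'v \<Rightarrow> 'k) \<Rightarrow> ('v \<Rightarrow> 'v) \<Rightarrow> bool" where
  "b_alternating scale b u \<longleftrightarrow> Vector_Spaces.linear scale scale u \<and> (\<forall>x. b x (u x) = 0)"

definition nilpotent_endo :: "('v::zero \<Rightarrow> 'v) \<Rightarrow> bool" where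
  "nilpotent_endo u \<longleftrightarrow> (\<exists>k. (u ^^ k) = (\<lambda>_. 0))"

definition partially_complete_flag ::
  "('k::field \<Rightarrow> 'v::ab_group_add \<Rightarrow> 'v) \<Rightarrow> nat \<Rightarrow> (nat \<Rightarrow> 'v set) \<Rightarrow> bool" where
  "partially_complete_flag scale p F \<longleftrightarrow>
     (\<forall>i\<le>p. module.subspace scale (F i) \<and> vector_space.dim scale (F i) = i) \<and>
     (\<forall>i<p. F i \<subseteq> F (Suc i))"

definition stabilizes_flag :: "nat \<Rightarrow> (nat \<Rightarrow> 'v set) \<Rightarrow> ('v \<Rightarrow> 'v) \<Rightarrow> bool" where
  "stabilizes_flag p F u \<longleftrightarrow> (\<forall>i\<le>p. u ` F i \<subseteq> F i)"

end

theory Submission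
  imports Defs "Jordan_Normal_Form.Char_Poly"
begin

text \<open>
  For a maximal singular flag \<open>F\<close> with radical term, let \<open>N(F)\<close> be the space of alternating endomorphisms
  that map each term of \<open>F\<close> into the preceding one; these are exactly the nilpotent stabilizers of \<open>F\<close>,
  and \<open>dim N(F)\<close> is at most the prescribed dimension. Let \<open>V\<close> be the given space. Since sums and
  differences of elements of \<open>V\<close> are nilpotent, \<open>tr (u v) = tr (u\<^sup>2 v) = 0\<close> on \<open>V\<close>.
  An alternating endomorphism that is trace-orthogonal to \<open>N(F)\<close> stabilizes \<open>F\<close>; comparing dimensions
  in the trace pairing of \<open>V\<close> with \<open>N(F)\<close> shows that every element of \<open>N(F)\<close> trace-orthogonal to \<open>V\<close>
  lies in \<open>V\<close>. Choosing \<open>F\<close> adapted to a single \<open>v \<in> V\<close> gives \<open>v\<^sup>2 \<in> V\<close>. So \<open>V\<close> is closed under the Jordan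
  product and by Jacobson's theorem it is triangularizable in a common singular flag \<open>F\<close>, whence
  \<open>V \<subseteq> N(F)\<close>, and equality holds by dimension.
\<close>

section \<open>Traces of products of nilpotent matrices\<close>

text \<open>Alternating endomorphisms are self-adjoint for \<open>b\<close>: squares of alternating
  maps are again alternating, while products and commutators in general are not. This is why
  triangularization goes through the Jordan product. When 0 < dim Rad < n, the trace pairing is
  degenerate on the space of all alternating endomorphisms, since a map that kills the radical and
  takes values in it is orthogonal to everything. Dimensions are therefore compared only between V
  and N(F), never with complements in the whole space. Origin of the prescribed dimension: put s = n
  - r = dim Rad and m = \<nu> - s. As 2 \<nu> = n + s, also m = n - \<nu>. The three terms come from
  strictly triangular maps of the radical, from maps of V modulo Rad into Rad, and from the
  nondegenerate quotient of dimension 2 m, which contributes m (m - 1).\<close>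

definition mtrace :: "'a::comm_monoid_add mat \<Rightarrow> 'a" where
  "mtrace A = (\<Sum>i<dim_row A. A $$ (i, i))"

lemma coeff_prod_one_plus_linear:
  assumes "finite I"
  shows "coeff (\<Prod>i\<in>I. 1 + [:0, a i:]) 0 = (1::'a::comm_ring_1)
    \<and> coeff (\<Prod>i\<in>I. 1 + [:0, a i:]) 1 = (\<Sum>i\<in>I. a i)"
  using assms by (induction I rule: finite_induct) (auto simp: algebra_simps coeff_mult)

text \<open>A permutation other than the identity moves at least two indices, so its term in the
  Leibniz expansion is divisible by the square of the variable.\<close>

lemma coeff_1_det_one_plus:
  fixes N :: "'a::comm_ring_1 mat"
  assumes N: "N \<in> carrier_mat n n"
  shows "coeff (det (1\<^sub>m n + map_mat (\<lambda>a. [:0, a:]) N)) 1 = mtrace N"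
proof -
  let ?M = "1\<^sub>m n + map_mat (\<lambda>a. [:0, a:]) N"
  let ?S = "{p. p permutes {0..<n}}"
  let ?t = "\<lambda>p. signof p * (\<Prod>i = 0..<n. ?M $$ (i, p i))"
  have M: "?M \<in> carrier_mat n n" using N by auto
  have fin: "finite ?S" by (simp add: finite_permutations)
  have off: "coeff (?t p) 1 = 0" if p: "p \<in> ?S" and ne: "p \<noteq> id" for p
  proof -
    have pp: "p permutes {0..<n}" using p by auto
    obtain i where i: "p i \<noteq> i" using ne by fastforce
    have i_lt: "i < n" using pp i by (metis permutes_not_in atLeastLessThan_iff le0)
    have pi_lt: "p i < n" using pp i_lt permutes_in_image by fastforce
    have ppi: "p (p i) \<noteq> p i" using i pp by (metis permutes_inj injD)
    have ppi_lt: "p (p i) < n" using pp pi_lt permutes_in_image by fastforce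
    have "(\<Prod>k = 0..<n. ?M $$ (k, p k)) =
        ?M $$ (i, p i) * (?M $$ (p i, p (p i)) * (\<Prod>k\<in>{0..<n} - {i} - {p i}. ?M $$ (k, p k)))"
      using i i_lt pi_lt by (simp add: prod.remove[of _ i] prod.remove[of _ "p i"])
    moreover have "?M $$ (i, p i) = [:0, N $$ (i, p i):]" using N i i_lt pi_lt by auto
    moreover have "?M $$ (p i, p (p i)) = [:0, N $$ (p i, p (p i)):]"
      using N ppi ppi_lt pi_lt by auto
    ultimately have "coeff (\<Prod>k = 0..<n. ?M $$ (k, p k)) 1 = 0"
      "coeff (\<Prod>k = 0..<n. ?M $$ (k, p k)) 0 = 0"
      by simp_all
    then show ?thesis by (simp add: coeff_mult)
  qed
  have "coeff (det ?M) 1 = (\<Sum>p\<in>?S. coeff (?t p) 1)"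
    unfolding det_def'[OF M] coeff_sum ..
  also have "\<dots> = (\<Sum>p\<in>{id}. coeff (?t p) 1)"
    by (rule sum.mono_neutral_right[OF fin]) (use off in \<open>force simp: permutes_id\<close>)+
  also have "\<dots> = coeff (\<Prod>i = 0..<n. 1 + [:0, N $$ (i, i):]) 1"
  proof -
    have "(\<Prod>i = 0..<n. ?M $$ (i, i)) = (\<Prod>i = 0..<n. 1 + [:0, N $$ (i, i):])"
      using N by (intro prod.cong) auto
    then show ?thesis by simp
  qed
  also have "\<dots> = mtrace N"
    using coeff_prod_one_plus_linear[of "{0..<n}" "\<lambda>i. N $$ (i, i)"] N
    by (simp add: mtrace_def lessThan_atLeast0)
  finally show ?thesis .
qed

text \<open>\<open>D\<close> is read as D(s, t) with t the outer and s the inner variable.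
  Evaluation at \<open>[:0, y:]\<close> substitutes t = y s and so collects the terms of equal total
  degree.\<close>

lemma coeff_poly_linear:
  fixes D :: "'a::comm_ring_1 poly poly"
  shows "coeff (poly D [:0, y:]) m = (\<Sum>j\<le>m. y ^ j * coeff (coeff D j) (m - j))"
proof (induction D arbitrary: m)
  case 0
  then show ?case by simp
next
  case (pCons a D)
  show ?case
  proof (cases m)
    case 0
    then show ?thesis by simp
  next
    case (Suc k)
    have "(\<Sum>j\<le>Suc k. y ^ j * coeff (coeff (pCons a D) j) (Suc k - j))
        = coeff a (Suc k) + y * (\<Sum>j\<le>k. y ^ j * coeff (coeff D j) (k - j))"
      by (subst sum.atMost_Suc_shift) (simp add: sum_distrib_left mult.assoc)
    then show ?thesis using Suc pCons.IH[of k] by simp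
  qed
qed

lemma pow_mat_commute:
  assumes X: "X \<in> carrier_mat n n"
  shows "X * X ^\<^sub>m k = X ^\<^sub>m k * X"
proof (induction k)
  case (Suc k)
  have "X * X ^\<^sub>m Suc k = (X * X ^\<^sub>m k) * X"
    using X by (simp add: assoc_mult_mat[of _ n n _ n _ n])
  then show ?case using Suc by simp
qed (use X in auto)

text \<open>Horner form of the truncated geometric series 1 + X + ... + X^(k-1). For X = s A with A
  nilpotent it is the inverse of 1 - X over the polynomial ring, once k is large enough.\<close>

primrec mgeom :: "nat \<Rightarrow> 'a::comm_ring_1 mat \<Rightarrow> nat \<Rightarrow> 'a mat" where
  "mgeom n X 0 = 0\<^sub>m n n"
| "mgeom n X (Suc k) = 1\<^sub>m n + X * mgeom n X k"

lemma mgeom_carrier [simp]: "X \<in> carrier_mat n n \<Longrightarrow> mgeom n X k \<in> carrier_mat n n"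
  by (induction k) auto

lemma one_minus_mult_mgeom:
  assumes X: "X \<in> carrier_mat n n"
  shows "(1\<^sub>m n - X) * mgeom n X k = 1\<^sub>m n - X ^\<^sub>m k"
proof (induction k)
  case 0
  then show ?case using X by auto
next
  case (Suc k)
  let ?G = "mgeom n X k"
  have G: "?G \<in> carrier_mat n n" using X by simp
  have IH: "?G - X * ?G = 1\<^sub>m n - X ^\<^sub>m k"
    using Suc X G by (simp add: minus_mult_distrib_mat[of _ n n])
  have P: "X ^\<^sub>m k \<in> carrier_mat n n" using X by simp
  note comm = pow_mat_commute[OF X]
  have "(1\<^sub>m n - X) * mgeom n X (Suc k) = (1\<^sub>m n + X * ?G) - X * (1\<^sub>m n + X * ?G)"
    using X G by (subst minus_mult_distrib_mat[of _ n n]) auto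
  also have "\<dots> = (1\<^sub>m n - X) + X * (?G - X * ?G)"
    using X G carrier_matD[OF G] by (auto simp: mult_minus_distrib_mat[of _ n n _ n] mult_add_distrib_mat[of _ n n _ n]
        intro!: eq_matI)
  also have "\<dots> = (1\<^sub>m n - X) + (X - X * X ^\<^sub>m k)"
    unfolding IH using X P by (simp add: mult_minus_distrib_mat[of _ n n _ n])
  also have "\<dots> = 1\<^sub>m n - X ^\<^sub>m (Suc k)"
    using X P comm by (auto intro!: eq_matI)
  finally show ?case .
qed

lemma sum_linear_poly:
  fixes f g :: "nat \<Rightarrow> 'a::comm_ring_1"
  shows "(\<Sum>l = 0..<n. [:f l:] * [:0, g l:]) = [:0, \<Sum>l = 0..<n. f l * g l:]"
  by (induction n) auto

lemma mtrace_mult: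
  assumes "A \<in> carrier_mat n n" and "B \<in> carrier_mat n n"
  shows "mtrace (A * B) = (\<Sum>i<n. \<Sum>j<n. A $$ (i, j) * B $$ (j, i))"
  using assms by (auto simp: mtrace_def scalar_prod_def lessThan_atLeast0 intro!: sum.cong)

lemma coeff_mgeom:
  fixes A :: "'a::comm_ring_1 mat"
  assumes A: "A \<in> carrier_mat n n" and "m < k" "i < n" "j < n"
  shows "coeff (mgeom n (map_mat (\<lambda>a. [:0, a:]) A) k $$ (i, j)) m = (A ^\<^sub>m m) $$ (i, j)"
  using assms(2-)
proof (induction k arbitrary: m i)
  case (Suc k)
  let ?X = "map_mat (\<lambda>a. [:0, a:]) A"
  have X: "?X \<in> carrier_mat n n" using A by simp
  have G: "mgeom n ?X k \<in> carrier_mat n n" using X by simp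
  have entry: "mgeom n ?X (Suc k) $$ (i, j) =
      (if i = j then 1 else 0) + (\<Sum>l = 0..<n. [:0, A $$ (i, l):] * mgeom n ?X k $$ (l, j))"
  proof -
    have "(?X * mgeom n ?X k) $$ (i, j) = (\<Sum>l = 0..<n. [:0, A $$ (i, l):] * mgeom n ?X k $$ (l, j))"
      using Suc.prems X G A by (auto simp: scalar_prod_def simp del: mgeom_carrier intro!: sum.cong)
    then show ?thesis using Suc.prems A carrier_matD[OF G] by auto
  qed
  show ?case
  proof (cases m)
    case 0
    then show ?thesis unfolding entry using A Suc.prems by (simp add: coeff_sum)
  next
    case (Suc m')
    have P: "A ^\<^sub>m m' \<in> carrier_mat n n" using A by simp
    have "coeff (mgeom n ?X (Suc k) $$ (i, j)) m
        = (\<Sum>l = 0..<n. A $$ (i, l) * coeff (mgeom n ?X k $$ (l, j)) m')"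
      unfolding entry using Suc by (simp add: coeff_sum)
    also have "\<dots> = (\<Sum>l = 0..<n. A $$ (i, l) * (A ^\<^sub>m m') $$ (l, j))"
      using Suc.prems Suc by (intro sum.cong refl) (simp add: Suc.IH)
    also have "\<dots> = (A * A ^\<^sub>m m') $$ (i, j)"
      using A P Suc.prems by (simp add: scalar_prod_def)
    finally show ?thesis using Suc pow_mat_commute[OF A] by simp
  qed
qed simp

abbreviation nilpotent_mat :: "nat \<Rightarrow> 'a::comm_ring_1 mat \<Rightarrow> bool" where
  "nilpotent_mat n A \<equiv> \<exists>k. A ^\<^sub>m k = 0\<^sub>m n n"

lemma map_linear_pow_mat:
  fixes A :: "'a::comm_ring_1 mat"
  assumes A: "A \<in> carrier_mat n n"
  shows "map_mat (\<lambda>a. [:0, a:]) A ^\<^sub>m k = map_mat (\<lambda>a. monom a k) (A ^\<^sub>m k)"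
proof (induction k)
  case 0
  then show ?case using A by (auto intro!: eq_matI simp: one_pCons monom_0)
next
  case (Suc k)
  have P: "A ^\<^sub>m k \<in> carrier_mat n n" using A by simp
  have "monom a k * [:0, c:] = monom (a * c) (Suc k)" for a c :: 'a
  proof -
    have "[:0, c:] = monom c 1" by (simp add: monom_altdef)
    then show ?thesis by (simp add: mult_monom)
  qed
  moreover have "(\<Sum>i = 0..<n. monom (f i) q) = monom (\<Sum>i = 0..<n. f i) q" for f :: "nat \<Rightarrow> 'a" and q
    by (induction n) (auto simp: add_monom)
  ultimately show ?case using A P Suc
    by (auto intro!: eq_matI simp: scalar_prod_def)
qed

lemma mgeom_inverse:
  fixes A :: "'a::comm_ring_1 mat"
  assumes A: "A \<in> carrier_mat n n" and nil: "A ^\<^sub>m k = 0\<^sub>m n n" and le: "k \<le> l"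
  shows "(1\<^sub>m n - map_mat (\<lambda>a. [:0, a:]) A) * mgeom n (map_mat (\<lambda>a. [:0, a:]) A) l = 1\<^sub>m n"
proof -
  have "A ^\<^sub>m (k + d) = 0\<^sub>m n n" for d
    using A nil by (induction d) auto
  then have "A ^\<^sub>m l = 0\<^sub>m n n" using le le_Suc_ex by blast
  then have "map_mat (\<lambda>a. [:0, a:]) A ^\<^sub>m l = 0\<^sub>m n n"
    unfolding map_linear_pow_mat[OF A] by (auto intro!: eq_matI)
  then show ?thesis
    using A one_minus_mult_mgeom[of "map_mat (\<lambda>a. [:0, a:]) A" n l] by auto
qed

lemma poly_det:
  fixes M :: "'a::comm_ring_1 poly mat"
  shows "poly (det M) x = det (map_mat (\<lambda>p. poly p x) M)"
proof -
  have "comm_ring_hom (\<lambda>p::'a poly. poly p x)" by unfold_locales auto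
  then show ?thesis by (simp add: comm_ring_hom.hom_det)
qed

text \<open>Since 1 - s A is invertible over the polynomials in s, its determinant is a unit there,
  hence constant, and s = 0 gives its value.\<close>

lemma det_one_minus_nilpotent:
  fixes A :: "'a::field mat"
  assumes A: "A \<in> carrier_mat n n" and nil: "nilpotent_mat n A"
  shows "det (1\<^sub>m n - map_mat (\<lambda>a. [:0, a:]) A) = 1"
proof -
  let ?X = "map_mat (\<lambda>a. [:0, a:]) A"
  let ?P = "1\<^sub>m n - ?X"
  obtain k where k: "A ^\<^sub>m k = 0\<^sub>m n n" using nil by auto
  have P: "?P \<in> carrier_mat n n" using A by auto
  have G: "mgeom n ?X k \<in> carrier_mat n n" using A by simp
  have "det ?P * det (mgeom n ?X k) = 1"
    using mgeom_inverse[OF A k order_refl] det_mult[OF P G] by simp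
  then have "det ?P dvd 1" by (metis dvdI)
  then have "degree (det ?P) = 0" by (metis is_unit_iff_degree dvd_0_left zero_neq_one)
  then obtain c where c: "det ?P = [:c:]" by (rule degree_eq_zeroE)
  have "poly (det ?P) 0 = det (map_mat (\<lambda>p. poly p 0) ?P)" by (rule poly_det)
  also have "map_mat (\<lambda>p. poly p 0) ?P = 1\<^sub>m n" using A by (auto intro!: eq_matI)
  finally have "poly (det ?P) 0 = 1" by simp
  then show ?thesis using c by (simp add: one_pCons)
qed

text \<open>In \<open>D(s, t) = det (1 - s A - t B)\<close> the coefficient of \<open>s\<^sup>m t\<close> is \<open>- tr (A\<^sup>m B)\<close>,
  whereas \<open>D(x, y x) = 1\<close> for each \<open>y\<close> such that \<open>A + y B\<close> is nilpotent. Power sums would not do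
  in characteristic 3.\<close>

lemma mtrace_mult_nilpotent:
  fixes A B :: "'a::field mat"
  assumes char: "(2::'a) \<noteq> 0"
    and A: "A \<in> carrier_mat n n" and B: "B \<in> carrier_mat n n"
    and nilA: "nilpotent_mat n A" and nilB: "nilpotent_mat n B"
    and nils: "nilpotent_mat n (A + B)" and nild: "nilpotent_mat n (A - B)"
  shows "mtrace (A * B) = 0" and "mtrace (A * A * B) = 0"
proof -
  let ?X = "map_mat (\<lambda>a. [:0, a:]) A"
  let ?P = "1\<^sub>m n - ?X"
  let ?B = "map_mat (\<lambda>a. [:a:]) B"
  \<comment> \<open>This is 1 - s A - t B: \<open>[:p:]\<close> views a polynomial in s as constant
    in t, and \<open>[:0, [:- a:]:]\<close> is - a t.\<close>
  define M where "M = map_mat (\<lambda>p. [:p:]) ?P + map_mat (\<lambda>a. [:0, [:- a:]:]) B"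
  define D where "D = det M"
  obtain k0 where k0: "A ^\<^sub>m k0 = 0\<^sub>m n n" using nilA by auto
  \<comment> \<open>Long enough for the series to invert 1 - s A, and at least 3 so that its
    coefficients up to s^2 can be read off.\<close>
  define k where "k = max k0 3"
  define G where "G = mgeom n ?X k"
  have k: "k0 \<le> k" "3 \<le> k" by (auto simp: k_def)
  have G: "G \<in> carrier_mat n n" using A by (simp add: G_def)
  have P: "?P \<in> carrier_mat n n" using A by auto
  have Bc: "?B \<in> carrier_mat n n" using B by auto
  have PG: "?P * G = 1\<^sub>m n" unfolding G_def by (rule mgeom_inverse[OF A k0 k(1)])
  \<comment> \<open>With G the inverse of 1 - s A, this choice gives M = (1 - s A) (1 + t N). The
    first factor has determinant 1, so the coefficient of t in D is the trace of N.\<close>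
  define N where "N = - (G * ?B)"
  have N: "N \<in> carrier_mat n n" using G Bc by (auto simp: N_def)
  have PN: "?P * N = - ?B"
  proof -
    have "?P * (G * ?B) = ?B"
      using assoc_mult_mat[OF P G Bc] PG left_mult_one_mat[OF Bc] by simp
    moreover have "?P * N = - (?P * (G * ?B))"
      unfolding N_def by (rule uminus_mult_right_mat) (use P G Bc in auto)
    ultimately show ?thesis by simp
  qed
  interpret C: comm_ring_hom "\<lambda>p::'a poly. [:p:]" by unfold_locales auto
  let ?L = "1\<^sub>m n + map_mat (\<lambda>a. [:0, a:]) N"
  have fac: "M = map_mat (\<lambda>p. [:p:]) ?P * ?L"
  proof (rule eq_matI)
    fix i j assume ij: "i < dim_row (map_mat (\<lambda>p. [:p:]) ?P * ?L)" "j < dim_col (map_mat (\<lambda>p. [:p:]) ?P * ?L)"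
    have ij': "i < n" "j < n" using ij A N by auto
    have "(map_mat (\<lambda>p. [:p:]) ?P * ?L) $$ (i, j) =
      (map_mat (\<lambda>p. [:p:]) ?P * 1\<^sub>m n + map_mat (\<lambda>p. [:p:]) ?P * map_mat (\<lambda>a. [:0, a:]) N) $$ (i, j)"
      using A N by (subst mult_add_distrib_mat[of _ n n _ n]) auto
    also have "\<dots> = (map_mat (\<lambda>p. [:p:]) ?P) $$ (i, j)
        + (map_mat (\<lambda>p. [:p:]) ?P * map_mat (\<lambda>a. [:0, a:]) N) $$ (i, j)"
      using A N ij' by (subst right_mult_one_mat[of _ n]) auto
    also have "(map_mat (\<lambda>p. [:p:]) ?P * map_mat (\<lambda>a. [:0, a:]) N) $$ (i, j)
        = (\<Sum>l = 0..<n. [:?P $$ (i, l):] * [:0, N $$ (l, j):])"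
      using P N A ij' by (auto simp: scalar_prod_def intro!: sum.cong)
    also have "\<dots> = [:0, \<Sum>l = 0..<n. ?P $$ (i, l) * N $$ (l, j):]"
      by (rule sum_linear_poly)
    also have "(\<Sum>l = 0..<n. ?P $$ (i, l) * N $$ (l, j)) = (?P * N) $$ (i, j)"
      using P N A ij' by (auto simp: scalar_prod_def)
    also have "\<dots> = [:- (B $$ (i, j)):]" unfolding PN using B ij' by auto
    finally show "M $$ (i, j) = (map_mat (\<lambda>p. [:p:]) ?P * ?L) $$ (i, j)"
      unfolding M_def using A B ij' by simp
  qed (use A B N in \<open>auto simp: M_def\<close>)
  have "D = det (map_mat (\<lambda>p. [:p:]) ?P) * det ?L"
    unfolding D_def fac by (rule det_mult[of _ n]) (use P N in auto)
  also have "det (map_mat (\<lambda>p. [:p:]) ?P) = 1"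
    unfolding C.hom_det det_one_minus_nilpotent[OF A nilA] by (simp add: one_pCons)
  finally have "coeff D 1 = mtrace N" using coeff_1_det_one_plus[OF N] by simp
  also have "\<dots> = - mtrace (G * ?B)"
    using G Bc by (auto simp: mtrace_def N_def sum_negf)
  finally have D1: "coeff D 1 = - (\<Sum>i<n. \<Sum>j<n. G $$ (i, j) * ?B $$ (j, i))"
    unfolding mtrace_mult[OF G Bc] .
  have d1: "coeff (coeff D 1) m = - mtrace (A ^\<^sub>m m * B)" if m: "m < k" for m
  proof -
    have "coeff (coeff D 1) m = - (\<Sum>i<n. \<Sum>j<n. coeff (G $$ (i, j)) m * B $$ (j, i))"
      unfolding D1 using B by (simp add: coeff_sum mult.commute)
    also have "\<dots> = - (\<Sum>i<n. \<Sum>j<n. (A ^\<^sub>m m) $$ (i, j) * B $$ (j, i))"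
      by (simp add: G_def coeff_mgeom[OF A m])
    finally show ?thesis using A B by (subst mtrace_mult[of _ n]) auto
  qed
  have ev: "poly D [:0, y:] = 1" if nil: "nilpotent_mat n (A + y \<cdot>\<^sub>m B)" for y
  proof -
    have "poly D [:0, y:] = det (map_mat (\<lambda>p. poly p [:0, y:]) M)"
      unfolding D_def by (rule poly_det)
    also have "map_mat (\<lambda>p. poly p [:0, y:]) M = 1\<^sub>m n - map_mat (\<lambda>a. [:0, a:]) (A + y \<cdot>\<^sub>m B)"
      using A B by (auto intro!: eq_matI simp: M_def)
    also have "det \<dots> = 1" by (rule det_one_minus_nilpotent) (use A B nil in auto)
    finally show ?thesis .
  qed
  have D0: "coeff D 0 = 1"
  proof -
    have "A + 0 \<cdot>\<^sub>m B = A" using A B by (auto intro!: eq_matI)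
    then show ?thesis using ev[of 0] nilA by (simp add: poly_0_coeff_0)
  qed
  \<comment> \<open>Setting s = 0 leaves det (1 - t B), which is 1 because B is nilpotent.\<close>
  have Dj0: "coeff (coeff D j) 0 = 0" if "j > 0" for j
  proof -
    interpret E0: comm_ring_hom "\<lambda>p::'a poly. poly p 0" by unfold_locales auto
    interpret E: map_poly_comm_ring_hom "\<lambda>p::'a poly. poly p 0" ..
    have mp: "map_poly (\<lambda>p. poly p 0) [:p, q:] = [:poly p 0, poly q 0:]" for p q :: "'a poly"
      by (intro poly_eqI) (simp add: coeff_map_poly coeff_pCons split: nat.splits)
    have "map_poly (\<lambda>p. poly p 0) D = det (map_mat (map_poly (\<lambda>p. poly p 0)) M)"
      by (simp add: D_def)
    also have "map_mat (map_poly (\<lambda>p. poly p 0)) M = 1\<^sub>m n - map_mat (\<lambda>a. [:0, a:]) B"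
      using A B by (auto intro!: eq_matI simp: M_def mp one_pCons)
    also have "det \<dots> = 1" by (rule det_one_minus_nilpotent[OF B nilB])
    finally have "coeff (map_poly (\<lambda>p. poly p 0) D) j = 0" using that by simp
    then show ?thesis by (simp add: coeff_map_poly poly_0_coeff_0)
  qed
  have evc: "(\<Sum>j\<le>m. y ^ j * coeff (coeff D j) (m - j)) = 0"
    if "nilpotent_mat n (A + y \<cdot>\<^sub>m B)" and "m > 0" for y m
    using ev[OF that(1)] coeff_poly_linear[of D y m] that(2) by simp
  have AB: "A + 1 \<cdot>\<^sub>m B = A + B" "A + (- 1) \<cdot>\<^sub>m B = A - B"
    using A B by (auto intro!: eq_matI)
  have p: "(\<Sum>j\<le>m. coeff (coeff D j) (m - j)) = 0"
    and q: "(\<Sum>j\<le>m. (- 1) ^ j * coeff (coeff D j) (m - j)) = 0" if "m > 0" for m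
    using evc[of 1 m] evc[of "- 1" m] that nils nild AB by simp_all
  have half: "x = 0" if "x + y = 0" "- x + y = 0" for x y :: 'a
  proof -
    have "2 * x = (x + y) - (- x + y)" by simp
    then have "2 * x = 0" using that by simp
    then show ?thesis using char by simp
  qed
  have e2: "(\<Sum>j\<le>2. f j) = f 0 + f 1 + f 2"
    and e3: "(\<Sum>j\<le>3. f j) = f 0 + f 1 + f 2 + f 3" for f :: "nat \<Rightarrow> 'a"
    by (simp_all add: numeral_2_eq_2 numeral_3_eq_3)
  have "coeff (coeff D 1) 1 + coeff (coeff D 2) 0 = 0"
    "- coeff (coeff D 1) 1 + coeff (coeff D 2) 0 = 0"
    using p[of 2] q[of 2] D0 unfolding e2 by simp_all
  then have "coeff (coeff D 1) 1 = 0" by (rule half)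
  then show "mtrace (A * B) = 0" using d1[of 1] k A by simp
  \<comment> \<open>In total degree 3 the coefficient of t^3 is already zero by \<open>Dj0\<close>.
    Two unknowns remain, for which y = 1 and y = -1 suffice, even over a field with three
    elements.\<close>
  have "coeff (coeff D 1) 2 + coeff (coeff D 2) 1 = 0"
    "- coeff (coeff D 1) 2 + coeff (coeff D 2) 1 = 0"
    using p[of 3] q[of 3] D0 Dj0[of 3] unfolding e3 by simp_all
  then have "coeff (coeff D 1) 2 = 0" by (rule half)
  moreover have "A ^\<^sub>m 2 = A * A" using A by (simp add: numeral_2_eq_2)
  ultimately show "mtrace (A * A * B) = 0" using d1[of 2] k by simp
qed

section \<open>Dimensions of subspaces and pairings\<close>

text \<open>Relative to a set, because the space of all functions on V is in general
  infinite-dimensional; dimensions are taken only of spaces of linear maps inside it.\<close>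

definition fin_dim :: "('k::comm_ring_1 \<Rightarrow> 'v::ab_group_add \<Rightarrow> 'v) \<Rightarrow> 'v set \<Rightarrow> bool" where
  "fin_dim scale V \<longleftrightarrow> (\<exists>B. finite B \<and> V \<subseteq> module.span scale B)"

context vector_space
begin

lemma fin_dim_subset: "fin_dim scale V \<Longrightarrow> W \<subseteq> V \<Longrightarrow> fin_dim scale W"
  unfolding fin_dim_def by blast

lemma fin_dim_basis_exists:
  assumes "subspace V" and "fin_dim scale V"
  shows "\<exists>C. finite C \<and> independent C \<and> C \<subseteq> V \<and> span C = V \<and> card C = dim V"
proof -
  obtain B where B: "finite B" "V \<subseteq> span B" using assms(2) by (auto simp: fin_dim_def)
  obtain C where C: "C \<subseteq> V" "independent C" "V \<subseteq> span C" "card C = dim V"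
    using basis_exists[of V] by metis
  have "finite C" using independent_span_bound[OF B(1) C(2)] C(1) B(2) by auto
  moreover have "span C = V" using C assms(1) by (simp add: span_minimal subset_antisym)
  ultimately show ?thesis using C by blast
qed

lemma card_le_dim_of_independent:
  assumes "subspace V" and "fin_dim scale V" and "independent C" and "C \<subseteq> V"
  shows "finite C" and "card C \<le> dim V"
proof -
  obtain D where D: "finite D" "span D = V" "card D = dim V"
    using fin_dim_basis_exists[OF assms(1,2)] by blast
  then show "finite C" "card C \<le> dim V"
    using independent_span_bound[OF D(1) assms(3)] assms(4) by auto
qed

lemma dim_mono_fin_dim:
  assumes "subspace V" and "fin_dim scale V" and "subspace W" and "W \<subseteq> V"
  shows "dim W \<le> dim V"
proof -
  obtain C where "independent C" "C \<subseteq> W" "card C = dim W"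
    using fin_dim_basis_exists[OF assms(3) fin_dim_subset[OF assms(2,4)]] by blast
  then show ?thesis using card_le_dim_of_independent[OF assms(1,2), of C] assms(4) by auto
qed

lemma subspace_eq_of_dim_le:
  assumes "subspace V" and "fin_dim scale V" and "subspace W" and "W \<subseteq> V" and "dim V \<le> dim W"
  shows "W = V"
proof (rule ccontr)
  assume "W \<noteq> V"
  then obtain x where x: "x \<in> V" "x \<notin> W" using assms(4) by blast
  obtain C where C: "finite C" "independent C" "C \<subseteq> W" "span C = W" "card C = dim W"
    using fin_dim_basis_exists[OF assms(3) fin_dim_subset[OF assms(2,4)]] by blast
  have "independent (insert x C)" using C x independent_insertI by auto
  moreover have "insert x C \<subseteq> V" using C x assms(4) by auto
  ultimately have "card (insert x C) \<le> dim V"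
    using card_le_dim_of_independent[OF assms(1,2)] by blast
  moreover have "x \<notin> C" using C x by auto
  ultimately show False using C assms(5) by simp
qed

lemma complement_exists:
  assumes "subspace V" and "fin_dim scale V" and "subspace W" and "W \<subseteq> V"
  shows "\<exists>J. finite J \<and> J \<subseteq> V \<and> V \<subseteq> span (W \<union> J) \<and> card J + dim W = dim V"
proof -
  obtain C where C: "finite C" "independent C" "C \<subseteq> W" "span C = W" "card C = dim W"
    using fin_dim_basis_exists[OF assms(3) fin_dim_subset[OF assms(2,4)]] by blast
  obtain D where D: "C \<subseteq> D" "D \<subseteq> V" "independent D" "V \<subseteq> span D"
    using maximal_independent_subset_extend[of C V] C assms(4) by (metis subset_trans)
  have fD: "finite D" using card_le_dim_of_independent[OF assms(1,2) D(3,2)] by simp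
  have cD: "card D = dim V" using basis_card_eq_dim D by blast
  have "V \<subseteq> span (W \<union> (D - C))"
    using D(4) C(3) span_mono[of D "W \<union> (D - C)"] by blast
  moreover have "card (D - C) + dim W = dim V"
    using C D fD cD card_mono[OF fD D(1)] by (simp add: card_Diff_subset)
  ultimately show ?thesis using fD D by (intro exI[of _ "D - C"]) auto
qed

lemma dim_le_Suc_dim_kernel:
  assumes V: "subspace V" "fin_dim scale V"
    and add: "\<And>x y. x \<in> V \<Longrightarrow> y \<in> V \<Longrightarrow> f (x + y) = f x + f y"
    and scl: "\<And>c x. x \<in> V \<Longrightarrow> f (c *s x) = c * f x"
  shows "subspace {x \<in> V. f x = 0}" and "dim V \<le> Suc (dim {x \<in> V. f x = 0})"
proof -
  let ?K = "{x \<in> V. f x = 0}"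
  have "f 0 = 0" using scl[of 0 0] V(1) by (simp add: subspace_0)
  then show K: "subspace ?K"
    using V add scl unfolding subspace_def by auto
  show "dim V \<le> Suc (dim ?K)"
  proof (cases "?K = V")
    case False
    then obtain x where x: "x \<in> V" "f x \<noteq> 0" by auto
    obtain C where C: "finite C" "span C = ?K" "card C = dim ?K"
      using fin_dim_basis_exists[OF K fin_dim_subset[OF V(2)]] by blast
    have "V \<subseteq> span (insert x C)"
    proof
      fix y assume y: "y \<in> V"
      let ?k = "f y / f x"
      have m: "(- ?k) *s x \<in> V" using V x subspace_scale by blast
      have "y + (- ?k) *s x \<in> ?K"
        using add[OF y m] scl[OF x(1), of "- ?k"] x subspace_add[OF V(1) y m] by simp
      then have "y - ?k *s x \<in> span C" unfolding C(2) by simp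
      then show "y \<in> span (insert x C)" unfolding span_insert by blast
    qed
    then have "dim V \<le> card (insert x C)" using dim_le_card C(1) by simp
    also have "\<dots> \<le> Suc (dim ?K)" using C by (simp add: card_insert_if)
    finally show ?thesis .
  qed simp
qed

lemma dim_le_card_plus_dim_kernel:
  assumes "finite I" and V: "subspace V" "fin_dim scale V"
    and add: "\<And>i x y. i \<in> I \<Longrightarrow> x \<in> V \<Longrightarrow> y \<in> V \<Longrightarrow> f i (x + y) = f i x + f i y"
    and scl: "\<And>i c x. i \<in> I \<Longrightarrow> x \<in> V \<Longrightarrow> f i (c *s x) = c * f i x"
  shows "subspace {x \<in> V. \<forall>i\<in>I. f i x = 0}
    \<and> dim V \<le> card I + dim {x \<in> V. \<forall>i\<in>I. f i x = 0}"
  using assms(1) add scl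
proof (induction I rule: finite_induct)
  case empty
  then show ?case using V by simp
next
  case (insert j I)
  let ?K = "{x \<in> V. \<forall>i\<in>I. f i x = 0}"
  have IH: "subspace ?K" "dim V \<le> card I + dim ?K" using insert by auto
  have fd: "fin_dim scale ?K" by (rule fin_dim_subset[OF V(2)]) auto
  have eq: "{x \<in> V. \<forall>i\<in>insert j I. f i x = 0} = {x \<in> ?K. f j x = 0}" by auto
  have "subspace {x \<in> ?K. f j x = 0}" "dim ?K \<le> Suc (dim {x \<in> ?K. f j x = 0})"
    using dim_le_Suc_dim_kernel[OF IH(1) fd, of "f j"] insert.prems by auto
  then show ?case unfolding eq using IH insert by auto
qed

end

text \<open>Modulo the right kernel, W is spanned by dim W - dim R vectors, and the functionals they
  define already cut out the left kernel in V. Bilinearity is asked only on V and W because tr (z u)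
  is additive in u only for linear z.\<close>

lemma pairing_dim_le:
  fixes s1 :: "'k::field \<Rightarrow> 'a::ab_group_add \<Rightarrow> 'a" and s2 :: "'k \<Rightarrow> 'b::ab_group_add \<Rightarrow> 'b"
    and \<beta> :: "'a \<Rightarrow> 'b \<Rightarrow> 'k"
  assumes vs: "vector_space s1" "vector_space s2"
    and V: "module.subspace s1 V" "fin_dim s1 V"
    and W: "module.subspace s2 W" "fin_dim s2 W"
    and addl: "\<And>x y z. x \<in> V \<Longrightarrow> y \<in> V \<Longrightarrow> z \<in> W \<Longrightarrow> \<beta> (x + y) z = \<beta> x z + \<beta> y z"
    and scll: "\<And>c x z. x \<in> V \<Longrightarrow> z \<in> W \<Longrightarrow> \<beta> (s1 c x) z = c * \<beta> x z"
    and addr: "\<And>x y z. x \<in> V \<Longrightarrow> y \<in> W \<Longrightarrow> z \<in> W \<Longrightarrow> \<beta> x (y + z) = \<beta> x y + \<beta> x z"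
    and sclr: "\<And>c x z. x \<in> V \<Longrightarrow> z \<in> W \<Longrightarrow> \<beta> x (s2 c z) = c * \<beta> x z"
  shows "vector_space.dim s1 V + vector_space.dim s2 {z \<in> W. \<forall>x\<in>V. \<beta> x z = 0}
    \<le> vector_space.dim s2 W + vector_space.dim s1 {x \<in> V. \<forall>z\<in>W. \<beta> x z = 0}"
proof -
  interpret v1: vector_space s1 by fact
  interpret v2: vector_space s2 by fact
  let ?R = "{z \<in> W. \<forall>x\<in>V. \<beta> x z = 0}"
  have z0: "\<beta> x 0 = 0" if "x \<in> V" for x
    using sclr[OF that v2.subspace_0[OF W(1)], of 0] by simp
  have R: "v2.subspace ?R"
    using W(1) addr sclr z0 unfolding v2.subspace_def by auto
  obtain J where J: "finite J" "J \<subseteq> W" "W \<subseteq> v2.span (?R \<union> J)" "card J + v2.dim ?R = v2.dim W"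
    using v2.complement_exists[OF W R] by blast
  have "x \<in> {x \<in> V. \<forall>z\<in>W. \<beta> x z = 0}" if x: "x \<in> {x \<in> V. \<forall>z\<in>J. \<beta> x z = 0}" for x
  proof -
    have "v2.subspace {z \<in> W. \<beta> x z = 0}"
      using W(1) addr sclr z0 x unfolding v2.subspace_def by auto
    moreover have "?R \<union> J \<subseteq> {z \<in> W. \<beta> x z = 0}" using x J by auto
    ultimately have "v2.span (?R \<union> J) \<subseteq> {z \<in> W. \<beta> x z = 0}" by (rule v2.span_minimal[rotated])
    then show ?thesis using J x by auto
  qed
  then have eq: "{x \<in> V. \<forall>z\<in>W. \<beta> x z = 0} = {x \<in> V. \<forall>z\<in>J. \<beta> x z = 0}" using J by auto
  have "v1.dim V \<le> card J + v1.dim {x \<in> V. \<forall>z\<in>J. \<beta> x z = 0}"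
    using v1.dim_le_card_plus_dim_kernel[OF J(1) V, of "\<lambda>z x. \<beta> x z"] addl scll J(2) by blast
  then show ?thesis unfolding eq using J(4) by simp
qed

section \<open>Jordan-closed spaces of nilpotent endomorphisms\<close>

lemma sum_fun_apply: "(\<Sum>i\<in>I. f i) x = (\<Sum>i\<in>I. f i x :: 'b::comm_monoid_add)"
  by (induction I rule: infinite_finite_induct) auto

lemma vector_space_fun_scale:
  assumes "vector_space scale"
  shows "vector_space (fun_scale scale)"
proof -
  interpret vector_space scale by fact
  show ?thesis
    by unfold_locales
      (auto simp: fun_scale_def fun_eq_iff scale_right_distrib scale_left_distrib)
qed

locale fd_endo = finite_dimensional_vector_space scale Basis
  for scale :: "'k::field \<Rightarrow> 'v::ab_group_add \<Rightarrow> 'v" (infixr \<open>*s\<close> 75) and Basis :: "'v set"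
begin

sublocale E: vector_space "fun_scale scale"
  by (rule vector_space_fun_scale) unfold_locales

abbreviation lin :: "('v \<Rightarrow> 'v) \<Rightarrow> bool" where
  "lin \<equiv> Vector_Spaces.linear scale scale"

lemma lin_iff: "lin u \<longleftrightarrow> (\<forall>x y. u (x + y) = u x + u y) \<and> (\<forall>c x. u (c *s x) = c *s u x)"
  unfolding Vector_Spaces.linear_iff using vector_space_axioms by auto

lemma lin_add: "lin u \<Longrightarrow> u (x + y) = u x + u y"
  and lin_scale: "lin u \<Longrightarrow> u (c *s x) = c *s u x"
  by (auto simp: lin_iff)

lemma lin_0: "lin u \<Longrightarrow> u 0 = 0"
  using lin_scale[of u 0 0] by simp

lemma lin_diff: "lin u \<Longrightarrow> u (x - y) = u x - u y"
  using lin_add[of u "x - y" y] by simp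

lemma lin_sum: "lin u \<Longrightarrow> u (\<Sum>i\<in>I. f i) = (\<Sum>i\<in>I. u (f i))"
  by (induction I rule: infinite_finite_induct) (auto simp: lin_0 lin_add)

lemma lin_funpow: "lin u \<Longrightarrow> lin (u ^^ k)"
  by (induction k) (auto simp: lin_iff)

lemma subspace_lin: "E.subspace {u. lin u}"
  unfolding E.subspace_def by (auto simp: lin_iff fun_scale_def algebra_simps)

lemma lin_expand: "lin u \<Longrightarrow> u x = (\<Sum>i\<in>Basis. representation Basis x i *s u i)"
proof -
  assume u: "lin u"
  have "x = (\<Sum>i\<in>Basis. representation Basis x i *s i)"
    using sum_representation_eq[OF independent_Basis _ finite_Basis subset_refl, of x] span_Basis by simp
  then show ?thesis using lin_sum[OF u, of "\<lambda>i. representation Basis x i *s i" Basis]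
    by (simp add: lin_scale[OF u])
qed

lemma fin_dim_lin: "fin_dim (fun_scale scale) {u. lin u}"
proof -
  let ?e = "\<lambda>i j x. representation Basis x i *s j"
  let ?B = "(\<lambda>(i, j). ?e i j) ` (Basis \<times> Basis)"
  have "u \<in> E.span ?B" if u: "lin u" for u
  proof -
    have "u = (\<Sum>i\<in>Basis. \<Sum>j\<in>Basis. fun_scale scale (representation Basis (u i) j) (?e i j))"
    proof
      fix x
      have "u i = (\<Sum>j\<in>Basis. representation Basis (u i) j *s j)" for i
        using sum_representation_eq[OF independent_Basis _ finite_Basis subset_refl, of "u i"] span_Basis
        by simp
      then have "u x = (\<Sum>i\<in>Basis. representation Basis x i *s (\<Sum>j\<in>Basis. representation Basis (u i) j *s j))"
        using lin_expand[OF u, of x] by simp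
      then show "u x = (\<Sum>i\<in>Basis. \<Sum>j\<in>Basis. fun_scale scale (representation Basis (u i) j) (?e i j)) x"
        by (simp add: sum_fun_apply fun_scale_def scale_sum_right mult.commute)
    qed
    moreover have "\<dots> \<in> E.span ?B"
      by (intro E.span_sum E.span_scale E.span_base) auto
    ultimately show ?thesis by simp
  qed
  then show ?thesis unfolding fin_dim_def using finite_Basis by (intro exI[of _ ?B]) auto
qed

lemma fin_dim_vectors: "fin_dim scale X"
  unfolding fin_dim_def using finite_Basis span_Basis by blast

text \<open>The orbit of x ends at 0, which lies in S; take the last iterate before it first enters
  S.\<close>

lemma nilpotent_escape:
  assumes nil: "nilpotent_endo u" and x: "x \<in> X" "x \<notin> S" and "0 \<in> S"
    and stab: "\<And>y. y \<in> X \<Longrightarrow> u y \<in> X"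
  shows "\<exists>y. y \<in> X \<and> y \<notin> S \<and> u y \<in> S"
proof -
  obtain k where k: "u ^^ k = (\<lambda>_. 0)" using nil by (auto simp: nilpotent_endo_def)
  have X: "(u ^^ j) x \<in> X" for j by (induction j) (auto simp: x stab)
  define m where "m = (LEAST j. (u ^^ j) x \<in> S)"
  have m: "(u ^^ m) x \<in> S" unfolding m_def by (rule LeastI[of _ k]) (simp add: k assms)
  then obtain j where j: "m = Suc j" using x by (cases m) auto
  then have "(u ^^ j) x \<notin> S" using not_less_Least[of j "\<lambda>j. (u ^^ j) x \<in> S"] m_def by simp
  then show ?thesis using X m j by (intro exI[of _ "(u ^^ j) x"]) auto
qed

text \<open>On every nonzero invariant subquotient T/S, the set U has a common kernel vector.
  Formulating this for subquotients, through representatives in T - S, lets it be applied inside the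
  radical and inside an orthogonal \<open>perp (F k)\<close> modulo \<open>F k\<close>.\<close>

definition triang :: "('v \<Rightarrow> 'v) set \<Rightarrow> bool" where
  "triang U \<longleftrightarrow> (\<forall>S T. subspace S \<and> subspace T \<and> S \<subset> T \<and> (\<forall>u\<in>U. u ` S \<subseteq> S \<and> u ` T \<subseteq> T)
     \<longrightarrow> (\<exists>x\<in>T - S. \<forall>u\<in>U. u x \<in> S))"

text \<open>Let X consist of the vectors of T that U sends into S. It is not contained in S, and v
  preserves it: u v x is the anticommutator applied to x minus v u x, and both lie in S. Nilpotency
  of v then yields a vector of X outside S that v sends into S.\<close>

lemma triang_insert:
  assumes U: "triang U" "\<And>u. u \<in> U \<Longrightarrow> lin u" and v: "lin v" "nilpotent_endo v"
    and anti: "\<And>u. u \<in> U \<Longrightarrow> (\<lambda>x. u (v x) + v (u x)) \<in> U"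
  shows "triang (insert v U)"
  unfolding triang_def
proof (intro allI impI, elim conjE)
  fix S T assume ST: "subspace S" "subspace T" "S \<subset> T"
    and stab: "\<forall>u\<in>insert v U. u ` S \<subseteq> S \<and> u ` T \<subseteq> T"
  let ?X = "{x \<in> T. \<forall>u\<in>U. u x \<in> S}"
  have "\<exists>x\<in>T - S. \<forall>u\<in>U. u x \<in> S"
    using U(1)[unfolded triang_def, rule_format, of S T] ST stab by simp
  then obtain x where x: "x \<in> ?X" "x \<notin> S" by blast
  have "v y \<in> ?X" if y: "y \<in> ?X" for y
  proof -
    have "u (v y) \<in> S" if u: "u \<in> U" for u
    proof -
      have "u (v y) + v (u y) \<in> S" using anti[OF u] y by auto
      moreover have "v (u y) \<in> S" using y u stab by auto
      ultimately have "(u (v y) + v (u y)) - v (u y) \<in> S" using ST subspace_diff by blast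
      then show ?thesis by simp
    qed
    then show ?thesis using y stab by auto
  qed
  then have "\<exists>y. y \<in> ?X \<and> y \<notin> S \<and> v y \<in> S"
    using nilpotent_escape[OF v(2) x subspace_0[OF ST(1)]] by blast
  then show "\<exists>x\<in>T - S. \<forall>u\<in>insert v U. u x \<in> S" by auto
qed

lemma triang_span:
  assumes "triang U"
  shows "triang (E.span U)"
proof -
  have sp: "u y \<in> S" if "u \<in> E.span U" "subspace S" "\<And>w. w \<in> U \<Longrightarrow> w y \<in> S" for u y S
    using that(1)
  proof (induction rule: E.span_induct_alt)
    case base
    then show ?case using subspace_0[OF that(2)] by simp
  next
    case (step c w u)
    then show ?case using that(2,3) by (auto simp: fun_scale_def subspace_add subspace_scale)
  qed
  show ?thesis
    unfolding triang_def
  proof (intro allI impI, elim conjE)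
    fix S T assume ST: "subspace S" "subspace T" "S \<subset> T"
      and stab: "\<forall>u\<in>E.span U. u ` S \<subseteq> S \<and> u ` T \<subseteq> T"
    have "\<forall>u\<in>U. u ` S \<subseteq> S \<and> u ` T \<subseteq> T" using stab E.span_base by blast
    then obtain x where "x \<in> T - S" "\<forall>u\<in>U. u x \<in> S" using assms ST unfolding triang_def by meson
    then show "\<exists>x\<in>T - S. \<forall>u\<in>E.span U. u x \<in> S" using sp[OF _ ST(1)] by blast
  qed
qed

text \<open>An analogue of the upper central series: the second term is the common kernel of U, and
  each later term is the preimage of the common kernel modulo the preceding one.\<close>

primrec kernel_chain :: "('v \<Rightarrow> 'v) set \<Rightarrow> nat \<Rightarrow> 'v set" where
  "kernel_chain U 0 = {0}"
| "kernel_chain U (Suc i) = {x. \<forall>u\<in>U. u x \<in> kernel_chain U i}"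

lemma subspace_kernel_chain:
  assumes "\<And>u. u \<in> U \<Longrightarrow> lin u"
  shows "subspace (kernel_chain U i)"
proof (induction i)
  case (Suc i)
  show ?case
    unfolding kernel_chain.simps
  proof (rule subspaceI)
    fix x y c assume x: "x \<in> {x. \<forall>u\<in>U. u x \<in> kernel_chain U i}"
    then show "c *s x \<in> {x. \<forall>u\<in>U. u x \<in> kernel_chain U i}"
      using Suc subspace_scale by (simp add: lin_scale[OF assms])
    assume "y \<in> {x. \<forall>u\<in>U. u x \<in> kernel_chain U i}"
    then show "x + y \<in> {x. \<forall>u\<in>U. u x \<in> kernel_chain U i}"
      using x Suc subspace_add by (simp add: lin_add[OF assms])
  qed (use Suc subspace_0 in \<open>simp add: lin_0[OF assms]\<close>)
qed simp

lemma kernel_chain_exhausts: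
  assumes U: "triang U" "\<And>u. u \<in> U \<Longrightarrow> lin u"
  shows "i \<le> j \<Longrightarrow> kernel_chain U i \<subseteq> kernel_chain U j"
    and "dim UNIV \<le> i \<Longrightarrow> kernel_chain U i = UNIV"
proof -
  let ?F = "kernel_chain U"
  have sub: "subspace (?F i)" for i by (rule subspace_kernel_chain[OF U(2)])
  have step: "?F i \<subseteq> ?F (Suc i)" for i
  proof (induction i)
    case 0
    then show ?case using U(2) lin_0 by auto
  next
    case (Suc i)
    then show ?case by (simp add: subset_iff)
  qed
  then show mono: "i \<le> j \<Longrightarrow> ?F i \<subseteq> ?F j" for i j by (rule lift_Suc_mono_le)
  have grow: "?F i = UNIV \<or> i \<le> dim (?F i)" for i
  proof (induction i)
    case (Suc i)
    show ?case
    proof (cases "?F i = UNIV")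
      case True
      then show ?thesis using step[of i] by auto
    next
      case False
      have "\<forall>u\<in>U. u ` ?F i \<subseteq> ?F i \<and> u ` UNIV \<subseteq> UNIV" using step[of i] by auto
      then have "\<exists>x\<in>UNIV - ?F i. \<forall>u\<in>U. u x \<in> ?F i"
        using U(1)[unfolded triang_def, rule_format, of "?F i" UNIV] sub False by auto
      then obtain x where x: "x \<notin> ?F i" "\<forall>u\<in>U. u x \<in> ?F i" by blast
      have "dim (?F i) < dim (?F (Suc i))"
      proof (rule ccontr)
        assume "\<not> ?thesis"
        then have "?F i = ?F (Suc i)"
          using subspace_dim_equal[OF sub sub step] by (simp add: not_less)
        then show False using x by auto
      qed
      then show ?thesis using Suc False by simp
    qed
  qed simp
  show "dim UNIV \<le> i \<Longrightarrow> ?F i = UNIV"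
    using grow[of i] sub[of i] subspace_dim_equal[OF sub[of i] subspace_UNIV] by auto
qed

text \<open>Jacobson's argument: let \<open>U\<close> be a largest triangularizable subspace. Anticommuting with \<open>U\<close>
  pushes an endomorphism deeper into the filtration defined by the kernel chain of \<open>U\<close>, so a deepest
  \<open>w \<in> V - U\<close> anticommutes with \<open>U\<close> into \<open>U\<close>, and \<open>U\<close> can be enlarged by \<open>w\<close>.\<close>

theorem triang_Jordan_closed:
  assumes V: "E.subspace V" and lin: "\<And>u. u \<in> V \<Longrightarrow> lin u"
    and nil: "\<And>u. u \<in> V \<Longrightarrow> nilpotent_endo u"
    and sq: "\<And>u. u \<in> V \<Longrightarrow> (\<lambda>x. u (u x)) \<in> V"
  shows "triang V"
proof -
  have fdV: "fin_dim (fun_scale scale) V"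
    by (rule E.fin_dim_subset[OF fin_dim_lin]) (use lin in auto)
  have anti: "(\<lambda>x. u (v x) + v (u x)) \<in> V" if u: "u \<in> V" and v: "v \<in> V" for u v
  proof -
    have uv: "u + v \<in> V" using V u v E.subspace_add by blast
    have "(\<lambda>x. (u + v) ((u + v) x)) - (\<lambda>x. u (u x)) - (\<lambda>x. v (v x)) \<in> V"
      using V sq[OF uv] sq[OF u] sq[OF v] E.subspace_diff by blast
    moreover have "(\<lambda>x. (u + v) ((u + v) x)) - (\<lambda>x. u (u x)) - (\<lambda>x. v (v x))
        = (\<lambda>x. u (v x) + v (u x))"
      by (rule ext) (simp add: lin_add[OF lin[OF u]] lin_add[OF lin[OF v]])
    ultimately show ?thesis by simp
  qed
  define P where "P d \<longleftrightarrow> (\<exists>U. E.subspace U \<and> U \<subseteq> V \<and> triang U \<and> E.dim U = d)" for d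
  have "triang {\<lambda>_. 0}" unfolding triang_def using subspace_0 by blast
  then have "triang {0}" by (simp add: zero_fun_def)
  then have "P (E.dim {0})" unfolding P_def using E.subspace_0[OF V] by (intro exI[of _ "{0}"]) auto
  moreover have "d \<le> E.dim V" if "P d" for d
    using that E.dim_mono_fin_dim[OF V fdV] unfolding P_def by blast
  ultimately have "P (Greatest P)" and great: "\<And>d. P d \<Longrightarrow> d \<le> Greatest P"
    by (metis GreatestI_nat, metis Greatest_le_nat)
  then obtain U where U: "E.subspace U" "U \<subseteq> V" "triang U" "E.dim U = Greatest P"
    unfolding P_def by blast
  have linU: "\<And>u. u \<in> U \<Longrightarrow> lin u" using U(2) lin by blast
  have "U = V"
  proof (rule ccontr)
    assume neq: "U \<noteq> V"
    let ?n = "dim UNIV"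
    let ?F = "kernel_chain U"
    have mono: "\<And>i j. i \<le> j \<Longrightarrow> ?F i \<subseteq> ?F j" and top: "\<And>i. ?n \<le> i \<Longrightarrow> ?F i = UNIV"
      using kernel_chain_exhausts[OF U(3) linU] by blast+
    have down: "u x \<in> ?F (i - 1)" if "u \<in> U" "x \<in> ?F i" for u x i
      using that by (cases i) (auto simp: lin_0[OF linU])
    \<comment> \<open>The number k - n measures how far w descends in the chain; the offset n keeps
      indices natural. \<open>Q 0\<close> is trivial because the chain is everything from index n
      on, and k > 2 n forces w = 0, so a greatest k exists.\<close>
    define Q where "Q k \<longleftrightarrow> (\<exists>w. w \<in> V - U \<and> (\<forall>i. w ` ?F i \<subseteq> ?F (i + ?n - k)))" for k
    have "Q 0" unfolding Q_def using neq U(2) top by auto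
    moreover have "k \<le> 2 * ?n" if "Q k" for k
    proof (rule ccontr)
      assume k: "\<not> k \<le> 2 * ?n"
      obtain w where w: "w \<in> V - U" "\<And>i. w ` ?F i \<subseteq> ?F (i + ?n - k)"
        using \<open>Q k\<close> unfolding Q_def by blast
      have "w x = 0" for x
      proof -
        have "w x \<in> ?F (?n + ?n - k)" using w(2)[of ?n] top[of ?n] by auto
        moreover have "?n + ?n - k = 0" using k by simp
        ultimately show ?thesis by simp
      qed
      then have "w = 0" by auto
      then show False using w E.subspace_0[OF U(1)] by simp
    qed
    ultimately have "Q (Greatest Q)" and greatQ: "\<And>d. Q d \<Longrightarrow> d \<le> Greatest Q"
      by (metis GreatestI_nat, metis Greatest_le_nat)
    then obtain w where w: "w \<in> V" "w \<notin> U" "\<And>i. w ` ?F i \<subseteq> ?F (i + ?n - Greatest Q)"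
      unfolding Q_def by blast
    have "(\<lambda>x. u (w x) + w (u x)) \<in> U" if u: "u \<in> U" for u
    proof (rule ccontr)
      let ?w = "\<lambda>x. u (w x) + w (u x)"
      assume "?w \<notin> U"
      moreover have "?w \<in> V" using anti u w U(2) by blast
      \<comment> \<open>Each of the two products contains one factor u, which lowers the index by
        one. For i = 0 truncated subtraction would spoil this count, but there x = 0.\<close>
      moreover have "?w x \<in> ?F (i + ?n - Suc (Greatest Q))" if x: "x \<in> ?F i" for x i
      proof (cases i)
        case 0
        then have "x = 0" using x by simp
        then show ?thesis using lin_0[OF linU[OF u]] lin_0[OF lin[OF w(1)]] mono[of 0] by auto
      next
        case (Suc j)
        have "w x \<in> ?F (i + ?n - Greatest Q)" using w(3) x by blast
        then have 1: "u (w x) \<in> ?F (i + ?n - Suc (Greatest Q))" using down[OF u] by fastforce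
        have "u x \<in> ?F j" using down[OF u x] Suc by simp
        then have "w (u x) \<in> ?F (j + ?n - Greatest Q)" using w(3) by blast
        then have 2: "w (u x) \<in> ?F (i + ?n - Suc (Greatest Q))" using Suc by simp
        show ?thesis using subspace_add[OF subspace_kernel_chain[OF linU] 1 2] .
      qed
      ultimately have "Q (Suc (Greatest Q))" unfolding Q_def by (intro exI[of _ ?w]) blast
      then show False using greatQ by fastforce
    qed
    then have "triang (insert w U)"
      by (intro triang_insert U(3) linU lin nil w(1))
    then have tr: "triang (E.span (insert w U))" by (rule triang_span)
    have sub: "E.span (insert w U) \<subseteq> V" using V U(2) w(1) by (intro E.span_minimal) auto
    then have "P (E.dim (E.span (insert w U)))" unfolding P_def using tr E.subspace_span by blast
    then have "E.dim (E.span (insert w U)) \<le> E.dim U" using great U(4) by simp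
    moreover have "U \<subseteq> E.span (insert w U)" using E.span_superset by blast
    ultimately have "U = E.span (insert w U)"
      using E.subspace_eq_of_dim_le[OF E.subspace_span E.fin_dim_subset[OF fdV sub] U(1)] by blast
    then show False using w(2) E.span_base by blast
  qed
  then show ?thesis using U(3) by simp
qed

end

section \<open>Traces of endomorphisms and of products of nilpotent ones\<close>

context fd_endo
begin

definition tr :: "('v \<Rightarrow> 'v) \<Rightarrow> 'k" where
  "tr u = (\<Sum>e\<in>Basis. representation Basis (u e) e)"

lemma in_span_Basis: "x \<in> span Basis"
  using span_Basis by simp

lemma rep_add: "representation Basis (x + y) e = representation Basis x e + representation Basis y e"
  by (simp add: representation_add[OF independent_Basis] in_span_Basis)

lemma rep_scale: "representation Basis (c *s x) e = c * representation Basis x e"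
  by (simp add: representation_scale[OF independent_Basis] in_span_Basis)

lemma rep_sum: "representation Basis (\<Sum>i\<in>I. f i) e = (\<Sum>i\<in>I. representation Basis (f i) e)"
  by (induction I rule: infinite_finite_induct) (auto simp: representation_zero rep_add)

lemma tr_add: "tr (u + v) = tr u + tr v"
  by (simp add: tr_def rep_add sum.distrib)

lemma tr_scale: "tr (fun_scale scale c u) = c * tr u"
  by (simp add: tr_def fun_scale_def rep_scale sum_distrib_left)

lemma tr_rank_one:
  assumes "\<And>x y. \<phi> (x + y) = \<phi> x + \<phi> y" and "\<And>c x. \<phi> (c *s x) = c * \<phi> x"
  shows "tr (\<lambda>w. \<phi> w *s x) = \<phi> x"
proof -
  have \<phi>0: "\<phi> 0 = 0" using assms(2)[of 0 0] by simp
  have sum: "\<phi> (\<Sum>i\<in>I. f i) = (\<Sum>i\<in>I. \<phi> (f i))" for I and f :: "'v \<Rightarrow> 'v"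
    by (induction I rule: infinite_finite_induct) (auto simp: assms(1) \<phi>0)
  have "\<phi> x = \<phi> (\<Sum>e\<in>Basis. representation Basis x e *s e)"
    using sum_representation_eq[OF independent_Basis in_span_Basis finite_Basis subset_refl, of x] by simp
  also have "\<dots> = (\<Sum>e\<in>Basis. representation Basis x e * \<phi> e)"
    unfolding sum by (simp add: assms(2))
  finally show ?thesis by (simp add: tr_def rep_scale mult.commute)
qed

lemma tr_mult_nilpotent:
  assumes char: "(2::'k) \<noteq> 0" and lin: "lin u" "lin v"
    and nil: "nilpotent_endo u" "nilpotent_endo v" "nilpotent_endo (u + v)" "nilpotent_endo (u - v)"
  shows "tr (\<lambda>x. u (v x)) = 0" and "tr (\<lambda>x. u (u (v x))) = 0"
proof -
  obtain xs where xs: "set xs = Basis" "distinct xs"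
    using finite_distinct_list[OF finite_Basis] by blast
  let ?n = "length xs"
  have bij: "bij_betw ((!) xs) {..<?n} Basis" using bij_betw_nth[OF xs(2) refl] xs(1) by simp
  define mt where "mt w = mat ?n ?n (\<lambda>(i, j). representation Basis (w (xs ! j)) (xs ! i))" for w
  have carr: "mt w \<in> carrier_mat ?n ?n" for w by (simp add: mt_def)
  have mult: "mt (\<lambda>x. w (z x)) = mt w * mt z" if w: "lin w" for w z
  proof (rule eq_matI)
    fix i j assume "i < dim_row (mt w * mt z)" "j < dim_col (mt w * mt z)"
    then have ij: "i < ?n" "j < ?n" by (auto simp: mt_def)
    have "mt (\<lambda>x. w (z x)) $$ (i, j) = representation Basis (w (z (xs ! j))) (xs ! i)"
      using ij by (simp add: mt_def)
    also have "\<dots> = (\<Sum>e\<in>Basis. representation Basis (z (xs ! j)) e * representation Basis (w e) (xs ! i))"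
      by (subst lin_expand[OF w]) (simp add: rep_sum rep_scale)
    also have "\<dots> = (\<Sum>l<?n. representation Basis (z (xs ! j)) (xs ! l) * representation Basis (w (xs ! l)) (xs ! i))"
      by (rule sum.reindex_bij_betw[OF bij, symmetric])
    also have "\<dots> = (mt w * mt z) $$ (i, j)"
      using ij by (simp add: mt_def scalar_prod_def lessThan_atLeast0 mult.commute)
    finally show "mt (\<lambda>x. w (z x)) $$ (i, j) = (mt w * mt z) $$ (i, j)" .
  qed (auto simp: mt_def)
  have pow: "mt (w ^^ k) = mt w ^\<^sub>m k" if w: "lin w" for w k
  proof (induction k)
    case 0
    have "representation Basis (xs ! j) (xs ! i) = (if i = j then 1 else 0)" if "i < ?n" "j < ?n" for i j
    proof -
      have "xs ! j \<in> Basis" using that xs(1) nth_mem by blast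
      then show ?thesis
        using that xs(2) by (auto simp: representation_basis[OF independent_Basis] nth_eq_iff_index_eq)
    qed
    then show ?case by (auto intro!: eq_matI simp: mt_def)
  next
    case (Suc k)
    have "w ^^ Suc k = (\<lambda>x. (w ^^ k) (w x))" by (simp only: funpow_Suc_right comp_def)
    then show ?case using mult[OF lin_funpow[OF w], of k w] Suc by simp
  qed
  have nilm: "nilpotent_mat ?n (mt w)" if w: "lin w" "nilpotent_endo w" for w
  proof -
    obtain k where "w ^^ k = (\<lambda>_. 0)" using w(2) by (auto simp: nilpotent_endo_def)
    then have "mt w ^\<^sub>m k = mt (\<lambda>_. 0)" using pow[OF w(1), of k] by simp
    also have "\<dots> = 0\<^sub>m ?n ?n" by (auto intro!: eq_matI simp: mt_def representation_zero)
    finally show ?thesis by blast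
  qed
  have trm: "mtrace (mt w) = tr w" for w
    unfolding tr_def mtrace_def using sum.reindex_bij_betw[OF bij, of "\<lambda>e. representation Basis (w e) e"]
    by (simp add: mt_def)
  have add: "mt (u + v) = mt u + mt v" by (auto intro!: eq_matI simp: mt_def rep_add)
  have "representation Basis (x - y) e = representation Basis x e - representation Basis y e" for x y e
    using rep_add[of "x - y" y e] by simp
  then have diff: "mt (u - v) = mt u - mt v" by (auto intro!: eq_matI simp: mt_def)
  have lin': "lin (u + v)" "lin (u - v)"
    using subspace_lin E.subspace_add[of "{u. lin u}" u v] E.subspace_diff[of "{u. lin u}" u v] lin by auto
  have "nilpotent_mat ?n (mt u + mt v)" "nilpotent_mat ?n (mt u - mt v)"
    using nilm[OF lin'(1) nil(3)] nilm[OF lin'(2) nil(4)] add diff by simp_all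
  note * = mtrace_mult_nilpotent[OF char carr carr nilm[OF lin(1) nil(1)] nilm[OF lin(2) nil(2)] this]
  have uu: "lin (\<lambda>x. u (u x))" using lin(1) by (simp add: lin_iff)
  show "tr (\<lambda>x. u (v x)) = 0" 
    using *(1) trm[of "\<lambda>x. u (v x)"] mult[OF lin(1), of v] by simp
  show "tr (\<lambda>x. u (u (v x))) = 0" 
    using *(2) trm[of "\<lambda>x. u (u (v x))"] mult[OF uu, of v] mult[OF lin(1), of u] by simp
qed

end

section \<open>Singular flags of an alternating form\<close>

locale alternating_space = fd_endo scale Basis
  for scale :: "'k::field \<Rightarrow> 'v::ab_group_add \<Rightarrow> 'v" (infixr \<open>*s\<close> 75) and Basis :: "'v set" +
  fixes b :: "'v \<Rightarrow> 'v \<Rightarrow> 'k"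
  assumes bil: "bilinear_form scale b" and alt: "alternating_form b" and char: "(2::'k) \<noteq> 0"
begin

lemma b_add_right: "b x (y + z) = b x y + b x z"
  and b_scale_right: "b x (c *s y) = c * b x y"
  and b_add_left: "b (x + y) z = b x z + b y z"
  and b_scale_left: "b (c *s x) z = c * b x z"
  using bil unfolding bilinear_form_def Vector_Spaces.linear_iff by blast+

lemma b_zero [simp]: "b x 0 = 0" "b 0 x = 0"
  using b_scale_right[of x 0 0] b_scale_left[of 0 0 x] by simp_all

lemma b_self [simp]: "b x x = 0"
  using alt by (simp add: alternating_form_def)

lemma b_skew: "b x y = - b y x"
proof -
  have "b (x + y) (x + y) = b x y + b y x"
    unfolding b_add_left b_add_right by simp
  then show ?thesis by (simp add: eq_neg_iff_add_eq_0)
qed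

lemma b_eq_0_sym: "b x y = 0 \<longleftrightarrow> b y x = 0"
  using b_skew[of x y] by simp

definition perp :: "'v set \<Rightarrow> 'v set" where
  "perp X = {y. \<forall>x\<in>X. b x y = 0}"

lemma subspace_perp [simp]: "subspace (perp X)"
  unfolding subspace_def perp_def by (simp add: b_add_right b_scale_right)

lemma subspace_Rad [simp]: "subspace (Rad b)"
  unfolding subspace_def Rad_def by (simp add: b_add_right b_scale_right)

lemma Rad_left: "x \<in> Rad b \<Longrightarrow> b x y = 0"
  using b_skew[of x y] by (simp add: Rad_def)

lemma Rad_subset_perp: "Rad b \<subseteq> perp X"
  by (auto simp: Rad_def perp_def)

lemma perp_Rad: "perp (Rad b) = UNIV"
  by (auto simp: perp_def Rad_left)

lemma perp_antimono: "X \<subseteq> Y \<Longrightarrow> perp Y \<subseteq> perp X"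
  by (auto simp: perp_def)

lemma subset_perp_perp: "X \<subseteq> perp (perp X)"
  unfolding perp_def using b_eq_0_sym by blast

text \<open>The pairing inequality is applied twice, with G on either side of \<open>b\<close>. The
  left and right orthogonals coincide by skew-symmetry, so the two inequalities combine to an
  equality.\<close>

lemma dim_perp:
  assumes G: "subspace G"
  shows "dim (perp G) + dim G = dim UNIV + dim (G \<inter> Rad b)"
proof -
  have vs: "vector_space scale" by unfold_locales
  note bb = b_add_left b_scale_left b_add_right b_scale_right
  have "dim UNIV + dim {z \<in> G. \<forall>x\<in>UNIV. b x z = 0} \<le> dim G + dim {x \<in> UNIV. \<forall>z\<in>G. b x z = 0}"
    by (rule pairing_dim_le[OF vs vs subspace_UNIV fin_dim_vectors G fin_dim_vectors]) (simp_all only: bb)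
  moreover have "{z \<in> G. \<forall>x\<in>UNIV. b x z = 0} = G \<inter> Rad b" by (auto simp: Rad_def)
  moreover have "{x \<in> UNIV. \<forall>z\<in>G. b x z = 0} = perp G"
    unfolding perp_def using b_eq_0_sym by blast
  moreover have "dim G + dim {z \<in> UNIV. \<forall>x\<in>G. b x z = 0} \<le> dim UNIV + dim {x \<in> G. \<forall>z\<in>UNIV. b x z = 0}"
    by (rule pairing_dim_le[OF vs vs G fin_dim_vectors subspace_UNIV fin_dim_vectors]) (simp_all only: bb)
  moreover have "{z \<in> UNIV. \<forall>x\<in>G. b x z = 0} = perp G" by (simp add: perp_def)
  moreover have "{x \<in> G. \<forall>z\<in>UNIV. b x z = 0} = G \<inter> Rad b"
    unfolding Rad_def using b_eq_0_sym by blast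
  ultimately show ?thesis by simp
qed

lemma dim_perp_Rad:
  assumes "subspace G" and "Rad b \<subseteq> G"
  shows "dim (perp G) + dim G = dim UNIV + dim (Rad b)"
  using dim_perp[OF assms(1)] assms(2) by (simp add: Int_absorb1)

lemma perp_perp:
  assumes "subspace G" and "Rad b \<subseteq> G"
  shows "perp (perp G) = G"
proof -
  have "dim (perp (perp G)) + dim (perp G) = dim UNIV + dim (Rad b)"
    by (rule dim_perp_Rad[OF subspace_perp Rad_subset_perp])
  then have "dim (perp (perp G)) = dim G" using dim_perp_Rad[OF assms] by simp
  then show ?thesis
    using subspace_dim_equal[OF assms(1) subspace_perp subset_perp_perp] by simp
qed

lemma dim_totally_singular:
  assumes X: "subspace X" "totally_singular b X"
  shows "2 * dim X \<le> dim UNIV + dim (Rad b)"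
proof -
  have "X \<subseteq> perp X" using X(2) by (auto simp: totally_singular_def perp_def)
  then have "dim X \<le> dim (perp X)" by (rule dim_subset)
  moreover have "dim (X \<inter> Rad b) \<le> dim (Rad b)" by (rule dim_subset) auto
  ultimately show ?thesis using dim_perp[OF X(1)] by simp
qed

abbreviation balt :: "('v \<Rightarrow> 'v) \<Rightarrow> bool" where
  "balt \<equiv> b_alternating scale b"

lemma balt_lin: "balt u \<Longrightarrow> lin u"
  by (simp add: b_alternating_def)

text \<open>Polarization makes b(x, u y) skew in x and y, and the skew-symmetry of \<open>b\<close>
  cancels that sign: u is self-adjoint, not skew-adjoint.\<close>

lemma balt_adjoint:
  assumes u: "balt u"
  shows "b x (u y) = b (u x) y"
proof -
  have "b (x + y) (u (x + y)) = 0" "b x (u x) = 0" "b y (u y) = 0"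
    using u by (auto simp: b_alternating_def)
  then have "b x (u y) + b y (u x) = 0"
    by (simp add: lin_add[OF balt_lin[OF u]] b_add_left b_add_right add.commute)
  then show ?thesis using b_skew[of y "u x"] by simp
qed

lemma subspace_balt: "E.subspace {u. balt u}"
  using subspace_lin unfolding E.subspace_def b_alternating_def
  by (auto simp: fun_scale_def b_add_right b_scale_right)

lemma balt_Rad: "balt u \<Longrightarrow> x \<in> Rad b \<Longrightarrow> u x \<in> Rad b"
  unfolding Rad_def by (simp add: balt_adjoint)

text \<open>The last equation stands for maximality: a totally singular X satisfies 2 dim X \<le> n
  + dim Rad, so equality makes p the Witt index (\<open>witt_index_eq\<close>) without handling a
  maximum.\<close>

definition singular_flag :: "nat \<Rightarrow> (nat \<Rightarrow> 'v set) \<Rightarrow> bool" where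
  "singular_flag p F \<longleftrightarrow> partially_complete_flag scale p F \<and> totally_singular b (F p)
     \<and> F (dim (Rad b)) = Rad b \<and> dim (Rad b) \<le> p \<and> 2 * p = dim UNIV + dim (Rad b)"

text \<open>Conditions are imposed only up to index p. By self-adjointness u also shifts the
  orthogonals of the flag, so for a singular flag its action on all of V is controlled.\<close>

definition nil_stab :: "nat \<Rightarrow> (nat \<Rightarrow> 'v set) \<Rightarrow> ('v \<Rightarrow> 'v) set" where
  "nil_stab p F = {u. balt u \<and> (\<forall>i<p. u ` F (Suc i) \<subseteq> F i)}"

lemma subspace_nil_stab:
  assumes "partially_complete_flag scale p F"
  shows "E.subspace (nil_stab p F)"
proof -
  have sub: "subspace (F i)" if "i < p" for i
    using assms that by (simp add: partially_complete_flag_def)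
  show ?thesis
  proof (rule E.subspaceI)
    show "0 \<in> nil_stab p F"
      using E.subspace_0[OF subspace_balt] subspace_0[OF sub] by (auto simp: nil_stab_def)
    fix u v c assume u: "u \<in> nil_stab p F"
    then show "fun_scale scale c u \<in> nil_stab p F"
      using E.subspace_scale[OF subspace_balt, of u c] subspace_scale[OF sub]
      by (auto simp: nil_stab_def fun_scale_def image_subset_iff)
    assume "v \<in> nil_stab p F"
    then show "u + v \<in> nil_stab p F"
      using u E.subspace_add[OF subspace_balt, of u v] subspace_add[OF sub]
      by (auto simp: nil_stab_def image_subset_iff)
  qed
qed

lemma flag_subset:
  assumes "partially_complete_flag scale p F" and "i \<le> j" "j \<le> p"
  shows "F i \<subseteq> F j"
  using assms(2,3)
proof (induction j)
  case (Suc j)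
  then show ?case using assms(1) unfolding partially_complete_flag_def
    by (metis Suc_leD Suc_le_lessD le_Suc_eq order_refl subset_trans)
qed simp

lemma insert_decompose:
  assumes "subspace S" and "subspace T" and "S \<subseteq> T" and "dim T = Suc (dim S)" and "x \<in> T" "x \<notin> S" and "y \<in> T"
  shows "\<exists>c. y - c *s x \<in> S"
proof -
  have sp: "span S = S" using assms(1) by (simp add: span_eq_iff)
  have "dim (span (insert x S)) = dim T"
    using dim_insert[of x S] assms sp by simp
  then have "span (insert x S) = T"
    using subspace_dim_equal[OF subspace_span assms(2) span_minimal[OF _ assms(2)], of "insert x S"] assms by simp
  then show ?thesis using assms(7) unfolding span_insert sp by auto
qed

text \<open>Vectors are added one at a time, from the radical until it is exhausted and from
  \<open>perp (F k)\<close> afterwards. Both are invariant under U, the second by self-adjointness,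
  so \<open>triang\<close> supplies a vector outside \<open>F k\<close> that U maps into
  \<open>F k\<close>. As b(x, x) = 0, adding x keeps the span totally singular.\<close>

lemma singular_flag_exists_aux:
  assumes tri: "triang U" and U: "\<And>u. u \<in> U \<Longrightarrow> balt u"
    and k: "k \<le> (dim UNIV + dim (Rad b) + 1) div 2"
  shows "\<exists>F. partially_complete_flag scale k F \<and> totally_singular b (F k)
    \<and> (k \<le> dim (Rad b) \<longrightarrow> F k \<subseteq> Rad b) \<and> (dim (Rad b) \<le> k \<longrightarrow> F (dim (Rad b)) = Rad b)
    \<and> (\<forall>u\<in>U. \<forall>i<k. u ` F (Suc i) \<subseteq> F i)"
  using k
proof (induction k)
  case 0
  show ?case
  proof (intro exI[of _ "\<lambda>_. {0}"] conjI impI)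
    show "{0} = Rad b" if "dim (Rad b) \<le> 0"
      using that subspace_0[OF subspace_Rad] by auto
    show "{0} \<subseteq> Rad b" using subspace_0[OF subspace_Rad] by simp
  qed (auto simp: partially_complete_flag_def totally_singular_def)
next
  case (Suc k)
  let ?s = "dim (Rad b)"
  have less: "2 * k < dim UNIV + ?s" using Suc.prems by linarith
  obtain F where F: "partially_complete_flag scale k F" "totally_singular b (F k)"
    and FR: "k \<le> ?s \<Longrightarrow> F k \<subseteq> Rad b" "?s \<le> k \<Longrightarrow> F ?s = Rad b"
    and FU: "\<And>u i. u \<in> U \<Longrightarrow> i < k \<Longrightarrow> u ` F (Suc i) \<subseteq> F i"
    using Suc.IH Suc.prems by (metis Suc_leD)
  have S: "subspace (F k)" "dim (F k) = k" using F(1) by (auto simp: partially_complete_flag_def)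
  have spS: "span (F k) = F k" using S by (simp add: span_eq_iff)
  have stabS: "u x \<in> F k" if u: "u \<in> U" and x: "x \<in> F k" for u x
  proof (cases k)
    case 0
    then have "x = 0" using S x by auto
    then show ?thesis using lin_0[OF balt_lin[OF U[OF u]]] subspace_0[OF S(1)] by simp
  next
    case (Suc j)
    then have "u x \<in> F j" using FU[OF u, of j] x by auto
    then show ?thesis using flag_subset[OF F(1), of j k] Suc by auto
  qed
  define T where "T = (if k < ?s then Rad b else perp (F k))"
  have T: "subspace T" by (simp add: T_def)
  have FT: "F k \<subseteq> T" using FR(1) F(2) by (auto simp: T_def perp_def totally_singular_def)
  have "k < dim T"
  proof (cases "k < ?s")
    case False
    then have "Rad b \<subseteq> F k" using FR(2) flag_subset[OF F(1), of ?s k] by auto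
    then show ?thesis using dim_perp_Rad[OF S(1)] S(2) less False by (simp add: T_def)
  qed (simp add: T_def)
  then have ne: "F k \<noteq> T" using S(2) by auto
  have stabT: "u x \<in> T" if u: "u \<in> U" and x: "x \<in> T" for u x
  proof (cases "k < ?s")
    case True
    then show ?thesis using x balt_Rad[OF U[OF u]] by (simp add: T_def)
  next
    case False
    then show ?thesis using x balt_adjoint[OF U[OF u]] stabS[OF u] by (simp add: T_def perp_def)
  qed
  have "F k \<subset> T" using FT ne by blast
  then have "\<exists>x\<in>T - F k. \<forall>u\<in>U. u x \<in> F k"
    using tri[unfolded triang_def, rule_format, of "F k" T] S(1) T stabS stabT by blast
  then obtain x where x: "x \<in> T" "x \<notin> F k" "\<And>u. u \<in> U \<Longrightarrow> u x \<in> F k" by blast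
  let ?S = "span (insert x (F k))"
  have memS: "\<exists>c z. z \<in> F k \<and> y = z + c *s x" if y: "y \<in> ?S" for y
  proof -
    obtain c where "y - c *s x \<in> F k" using y unfolding span_insert spS by auto
    then show ?thesis by (intro exI[of _ c] exI[of _ "y - c *s x"]) simp
  qed
  have bx: "b z x = 0" if "z \<in> F k" for z
    using x(1) that by (auto simp: T_def perp_def Rad_def split: if_splits)
  have dimS: "dim ?S = Suc k" using dim_insert[of x "F k"] x(2) S spS by simp
  have FS: "F k \<subseteq> ?S" using span_superset by blast
  let ?F = "F(Suc k := ?S)"
  show ?case
  proof (intro exI[of _ ?F] conjI impI)
    show "partially_complete_flag scale (Suc k) ?F"
      using F(1) dimS FS unfolding partially_complete_flag_def by (auto simp: le_Suc_eq less_Suc_eq)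
    show "totally_singular b (?F (Suc k))"
      unfolding totally_singular_def
    proof (intro ballI)
      fix y y' assume "y \<in> ?F (Suc k)" "y' \<in> ?F (Suc k)"
      then have "y \<in> ?S" "y' \<in> ?S" by simp_all
      obtain c z where "z \<in> F k" "y = z + c *s x" using memS[OF \<open>y \<in> ?S\<close>] by blast
      moreover obtain c' z' where "z' \<in> F k" "y' = z' + c' *s x"
        using memS[OF \<open>y' \<in> ?S\<close>] by blast
      moreover have "b x z' = 0" using bx[of z'] b_skew[of x z'] \<open>z' \<in> F k\<close> by simp
      moreover have "b z z' = 0" using F(2) \<open>z \<in> F k\<close> \<open>z' \<in> F k\<close> by (simp add: totally_singular_def)
      ultimately show "b y y' = 0"
        using bx by (simp add: b_add_left b_add_right b_scale_left b_scale_right)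
    qed
    have SR: "?S \<subseteq> Rad b" if "Suc k \<le> ?s"
      using x(1) FR(1) that by (intro span_minimal) (auto simp: T_def)
    then show "?F (Suc k) \<subseteq> Rad b" if "Suc k \<le> ?s" using that by simp
    show "?F ?s = Rad b" if "?s \<le> Suc k"
    proof (cases "?s = Suc k")
      case True
      then show ?thesis
        using subspace_dim_equal[OF subspace_span subspace_Rad SR] dimS by simp
    next
      case False
      then show ?thesis using that FR(2) by simp
    qed
    show "\<forall>u\<in>U. \<forall>i<Suc k. u ` ?F (Suc i) \<subseteq> ?F i"
    proof (intro ballI allI impI subsetI)
      fix u i y assume u: "u \<in> U" and i: "i < Suc k" and y: "y \<in> u ` ?F (Suc i)"
      show "y \<in> ?F i"
      proof (cases "i = k")
        case True
        then obtain w where w: "w \<in> ?S" "y = u w" using y by auto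
        then obtain c z where z: "z \<in> F k" "w = z + c *s x" using memS by blast
        have "u w = u z + c *s u x"
          using z lin_add[OF balt_lin[OF U[OF u]]] lin_scale[OF balt_lin[OF U[OF u]]] by simp
        then have "u w \<in> F k"
          using stabS[OF u z(1)] x(3)[OF u] S(1) by (simp add: subspace_add subspace_scale)
        then show ?thesis using w True by simp
      next
        case False
        then have "y \<in> F i" using FU[OF u, of i] i y by auto
        then show ?thesis using i by simp
      qed
    qed
  qed
qed

lemma singular_flag_exists:
  assumes "triang U" and "\<And>u. u \<in> U \<Longrightarrow> balt u"
  shows "\<exists>p F. singular_flag p F \<and> U \<subseteq> nil_stab p F"
proof -
  \<comment> \<open>Rounded up, since the parity of n + dim Rad is unknown at this point. The
    totally singular \<open>F ?p\<close> has dimension at most half of n + dim Rad, which forces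
    that number to be even.\<close>
  let ?p = "(dim UNIV + dim (Rad b) + 1) div 2"
  obtain F where F: "partially_complete_flag scale ?p F" "totally_singular b (F ?p)"
    "dim (Rad b) \<le> ?p \<Longrightarrow> F (dim (Rad b)) = Rad b"
    "\<And>u i. u \<in> U \<Longrightarrow> i < ?p \<Longrightarrow> u ` F (Suc i) \<subseteq> F i"
    using singular_flag_exists_aux[OF assms order_refl] by auto
  have "subspace (F ?p)" "dim (F ?p) = ?p" using F(1) by (auto simp: partially_complete_flag_def)
  then have "2 * ?p \<le> dim UNIV + dim (Rad b)" using dim_totally_singular[of "F ?p"] F(2) by simp
  then have p: "2 * ?p = dim UNIV + dim (Rad b)" by linarith
  moreover have "dim (Rad b) \<le> dim UNIV" by (rule dim_subset) simp
  ultimately have "singular_flag ?p F" using F unfolding singular_flag_def by auto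
  moreover have "U \<subseteq> nil_stab ?p F" using assms(2) F(4) unfolding nil_stab_def by blast
  ultimately show ?thesis by blast
qed

lemma triang_singleton:
  assumes "lin v" and "nilpotent_endo v"
  shows "triang {v}"
proof -
  have "triang {}" unfolding triang_def by blast
  then show ?thesis using triang_insert[of "{}" v] assms by simp
qed

lemma witt_index_eq:
  assumes "singular_flag p F"
  shows "witt_index scale b = p"
  unfolding witt_index_def
proof (rule Max_eqI)
  have "{dim X |X. subspace X \<and> totally_singular b X} \<subseteq> {..dim UNIV}"
    using dim_subset[OF subset_UNIV] by auto
  then show "finite {dim X |X. subspace X \<and> totally_singular b X}"
    by (rule finite_subset) simp
  fix d assume "d \<in> {dim X |X. subspace X \<and> totally_singular b X}"
  then have "2 * d \<le> dim UNIV + dim (Rad b)" using dim_totally_singular by auto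
  then show "d \<le> p" using assms by (simp add: singular_flag_def)
next
  show "p \<in> {dim X |X. subspace X \<and> totally_singular b X}"
    using assms unfolding singular_flag_def partially_complete_flag_def
    by (intro CollectI exI[of _ "F p"]) auto
qed

end

section \<open>Trace orthogonality and nilpotent stabilizers of a singular flag\<close>

context alternating_space
begin

lemma separating_functional:
  assumes S: "subspace S" and x: "x \<notin> S"
  shows "\<exists>\<phi> :: 'v \<Rightarrow> 'k. (\<forall>y z. \<phi> (y + z) = \<phi> y + \<phi> z) \<and> (\<forall>c y. \<phi> (c *s y) = c * \<phi> y)
    \<and> \<phi> x = 1 \<and> (\<forall>y\<in>S. \<phi> y = 0)"
proof -
  obtain C where C: "independent C" "C \<subseteq> S" "span C = S"
    using fin_dim_basis_exists[OF S fin_dim_vectors] by blast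
  have ind: "independent (insert x C)" using C x independent_insertI by simp
  let ?D = "extend_basis (insert x C)"
  have D: "insert x C \<subseteq> ?D" "independent ?D" "span ?D = UNIV"
    using extend_basis_superset[OF ind] independent_extend_basis[OF ind] span_extend_basis[OF ind] by auto
  let ?\<phi> = "\<lambda>y. representation ?D y x"
  have "?\<phi> y = 0" if "y \<in> S" for y
  proof -
    have "representation ?D y = representation C y"
      by (rule representation_extend[OF D(2)]) (use that C(3) D(1) in auto)
    moreover have "representation C y x = 0"
      using representation_ne_zero[of C y x] C x by blast
    ultimately show ?thesis by simp
  qed
  moreover have "?\<phi> x = 1" using D by (simp add: representation_basis)
  ultimately show ?thesis
    using D by (intro exI[of _ ?\<phi>]) (simp add: representation_add representation_scale)
qed

lemma singular_flagD:
  assumes "singular_flag p F"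
  shows "partially_complete_flag scale p F" "totally_singular b (F p)" "F (dim (Rad b)) = Rad b"
    "dim (Rad b) \<le> p" "2 * p = dim UNIV + dim (Rad b)"
    "\<And>i. i \<le> p \<Longrightarrow> subspace (F i)" "\<And>i. i \<le> p \<Longrightarrow> dim (F i) = i"
    "\<And>i j. i \<le> j \<Longrightarrow> j \<le> p \<Longrightarrow> F i \<subseteq> F j"
    "\<And>x y. x \<in> F p \<Longrightarrow> y \<in> F p \<Longrightarrow> b x y = 0"
    "\<And>i. dim (Rad b) \<le> i \<Longrightarrow> i \<le> p \<Longrightarrow> Rad b \<subseteq> F i"
    "\<And>i. i \<le> dim (Rad b) \<Longrightarrow> F i \<subseteq> Rad b"
proof -
  show pcf: "partially_complete_flag scale p F" "totally_singular b (F p)" "F (dim (Rad b)) = Rad b"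
    "dim (Rad b) \<le> p" "2 * p = dim UNIV + dim (Rad b)"
    using assms unfolding singular_flag_def by blast+
  show "\<And>i. i \<le> p \<Longrightarrow> subspace (F i)" "\<And>i. i \<le> p \<Longrightarrow> dim (F i) = i"
    using pcf(1) by (auto simp: partially_complete_flag_def)
  show sub: "\<And>i j. i \<le> j \<Longrightarrow> j \<le> p \<Longrightarrow> F i \<subseteq> F j" by (rule flag_subset[OF pcf(1)])
  show "\<And>x y. x \<in> F p \<Longrightarrow> y \<in> F p \<Longrightarrow> b x y = 0" using pcf(2) by (simp add: totally_singular_def)
  show "\<And>i. dim (Rad b) \<le> i \<Longrightarrow> i \<le> p \<Longrightarrow> Rad b \<subseteq> F i"
    "\<And>i. i \<le> dim (Rad b) \<Longrightarrow> F i \<subseteq> Rad b"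
    using sub pcf(3,4) by metis+
qed

text \<open>The test elements are the maps \<open>w \<mapsto> \<phi>(w) x\<close> with \<open>x\<close> in the radical, and
  \<open>w \<mapsto> b(x,w) y - b(y,w) x\<close>.\<close>

lemma stabilizes_of_trace:
  assumes F: "singular_flag p F" and u: "balt u"
    and tr0: "\<And>z. z \<in> nil_stab p F \<Longrightarrow> tr (\<lambda>x. z (u x)) = 0"
    and i: "i \<le> p" and x: "x \<in> F i"
  shows "u x \<in> F i"
proof -
  note F' = singular_flagD[OF F]
  note linu = balt_lin[OF u]
  show ?thesis
  proof (cases "i \<le> dim (Rad b)")
    case True
    have xR: "x \<in> Rad b" using F'(11)[OF True] x by blast
    show ?thesis
    proof (rule ccontr)
      assume "u x \<notin> F i"
      then obtain \<phi> :: "'v \<Rightarrow> 'k" where \<phi>: "\<And>y z. \<phi> (y + z) = \<phi> y + \<phi> z" "\<And>c y. \<phi> (c *s y) = c * \<phi> y"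
        "\<phi> (u x) = 1" "\<And>y. y \<in> F i \<Longrightarrow> \<phi> y = 0"
        using separating_functional[OF F'(6)[OF i]] by blast
      \<comment> \<open>Alternating because its values lie in the radical. Its product with u has
        trace \<phi>(u x) = 1, against \<open>tr0\<close>.\<close>
      let ?z = "\<lambda>w. \<phi> w *s x"
      have "balt ?z"
        using xR by (auto simp: b_alternating_def lin_iff \<phi> scale_left_distrib b_scale_right Rad_def)
      moreover have "?z w \<in> F j" if j: "j < p" and w: "w \<in> F (Suc j)" for j w
      proof (cases "Suc j \<le> i")
        case True
        then have "\<phi> w = 0" using \<phi>(4) F'(8)[OF True i] w by blast
        then show ?thesis using subspace_0[OF F'(6)] j by simp
      next
        case False
        then have "x \<in> F j" using F'(8)[of i j] j x by auto
        then show ?thesis using subspace_scale[OF F'(6)] j by simp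
      qed
      ultimately have "?z \<in> nil_stab p F" by (auto simp: nil_stab_def)
      then have "tr (\<lambda>w. \<phi> (u w) *s x) = 0" by (rule tr0)
      moreover have "tr (\<lambda>w. \<phi> (u w) *s x) = \<phi> (u x)"
        by (rule tr_rank_one) (simp_all add: lin_add[OF linu] lin_scale[OF linu] \<phi>(1,2))
      ultimately show False using \<phi>(3) by simp
    qed
  next
    case False
    then have RF: "Rad b \<subseteq> F i" using F'(10) i by simp
    \<comment> \<open>As the radical lies in \<open>F i\<close>, this subspace equals its double
      orthogonal, so membership of u x can be tested with \<open>b\<close>. The two rank-one terms
      of \<open>?z\<close> contribute equally, and the trace becomes -2 b(y, u x).\<close>
    have "b y (u x) = 0" if y: "y \<in> perp (F i)" for y
    proof -
      have yF: "b y w = 0" if "w \<in> F i" for w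
        using y that b_eq_0_sym by (auto simp: perp_def)
      let ?z = "\<lambda>w. b x w *s y + (- b y w) *s x"
      have "b w (?z w) = 0" for w
        unfolding b_add_right b_scale_right using b_skew[of w y] b_skew[of w x] by simp
      moreover have "lin ?z"
        by (auto simp: lin_iff b_add_right b_scale_right algebra_simps)
      ultimately have "balt ?z" unfolding b_alternating_def by blast
      moreover have "?z w \<in> F j" if j: "j < p" and w: "w \<in> F (Suc j)" for j w
      proof -
        \<comment> \<open>The vector y may lie outside the flag, but its coefficient b(x, w)
          vanishes since x and w both lie in the totally singular \<open>F p\<close>.\<close>
        have "w \<in> F p" "x \<in> F p" using F'(8)[of "Suc j" p] F'(8)[of i p] j w x i by auto
        then have "b x w = 0" using F'(9) by blast
        moreover have "b y w *s x \<in> F j"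
        proof (cases "Suc j \<le> i")
          case True
          then have "b y w = 0" using yF F'(8)[OF True i] w by blast
          then show ?thesis using subspace_0[OF F'(6)] j by simp
        next
          case False
          then have "x \<in> F j" using F'(8)[of i j] j x by auto
          then show ?thesis using subspace_scale[OF F'(6)] j by simp
        qed
        ultimately show ?thesis using subspace_neg[OF F'(6)] j by simp
      qed
      ultimately have "?z \<in> nil_stab p F" unfolding nil_stab_def by blast
      then have "tr (\<lambda>w. b x (u w) *s y + (- b y (u w)) *s x) = 0" by (rule tr0)
      moreover have "tr (\<lambda>w. b x (u w) *s y + (- b y (u w)) *s x)
          = tr (\<lambda>w. b x (u w) *s y) + tr (\<lambda>w. (- b y (u w)) *s x)"
        using tr_add[of "\<lambda>w. b x (u w) *s y" "\<lambda>w. (- b y (u w)) *s x"] by (simp add: plus_fun_def)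
      moreover have "tr (\<lambda>w. b x (u w) *s y) = b x (u y)"
        by (rule tr_rank_one) (simp_all add: lin_add[OF linu] lin_scale[OF linu] b_add_right b_scale_right)
      moreover have "tr (\<lambda>w. (- b y (u w)) *s x) = - b y (u x)"
        by (rule tr_rank_one) (simp_all add: lin_add[OF linu] lin_scale[OF linu] b_add_right b_scale_right)
      moreover have "b x (u y) = - b y (u x)"
        using balt_adjoint[OF u, of x y] b_skew[of "u x" y] by simp
      ultimately have "2 * b y (u x) = 0" by simp
      then show ?thesis using char by simp
    qed
    then have "u x \<in> perp (perp (F i))" by (simp add: perp_def)
    then show ?thesis using perp_perp[OF F'(6)[OF i] RF] by simp
  qed
qed

text \<open>Each quotient of consecutive terms is a line, and a nilpotent map of a line is
  zero.\<close>

lemma nil_stab_of_nilpotent: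
  assumes F: "partially_complete_flag scale p F" and u: "balt u" "nilpotent_endo u"
    and stab: "\<And>i x. i \<le> p \<Longrightarrow> x \<in> F i \<Longrightarrow> u x \<in> F i"
  shows "u \<in> nil_stab p F"
proof -
  have "u x \<in> F i" if i: "i < p" and x: "x \<in> F (Suc i)" for i x
  proof -
    have sub: "subspace (F i)" "subspace (F (Suc i))" "dim (F i) = i" "dim (F (Suc i)) = Suc i"
      "F i \<subseteq> F (Suc i)" using F i by (auto simp: partially_complete_flag_def)
    have "F i \<noteq> F (Suc i)" using sub(3,4) by auto
    then obtain y0 where "y0 \<in> F (Suc i)" "y0 \<notin> F i" using sub(5) by blast
    then obtain y where y: "y \<in> F (Suc i)" "y \<notin> F i" "u y \<in> F i"
      using nilpotent_escape[OF u(2) _ _ subspace_0[OF sub(1)], of y0 "F (Suc i)"] stab i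
      by (meson Suc_leI)
    obtain c where c: "x - c *s y \<in> F i"
      using insert_decompose[OF sub(1,2,5) _ y(1,2) x] sub by auto
    have "u (x - c *s y) \<in> F i" using stab c i by simp
    then have "u (x - c *s y) + c *s u y \<in> F i" using y(3) sub(1) subspace_add subspace_scale by blast
    moreover have "u (x - c *s y) + c *s u y = u x"
      by (simp add: lin_diff[OF balt_lin[OF u(1)]] lin_scale[OF balt_lin[OF u(1)]])
    ultimately show ?thesis by simp
  qed
  then show ?thesis using u by (auto simp: nil_stab_def)
qed

lemma nil_stab_stabilizes:
  assumes F: "partially_complete_flag scale p F" and u: "u \<in> nil_stab p F" and "i \<le> p" and "x \<in> F i"
  shows "u x \<in> F i"
proof (cases i)
  case 0
  then have "subspace (F i)" "dim (F i) = 0" using F by (auto simp: partially_complete_flag_def)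
  then have "x = 0" using assms(4) by auto
  then show ?thesis using u lin_0[OF balt_lin, of u] assms(4) by (simp add: nil_stab_def)
next
  case (Suc j)
  then have "u x \<in> F j" using u assms(3,4) by (auto simp: nil_stab_def Suc_le_eq)
  then show ?thesis using flag_subset[OF F, of j i] assms(3) Suc by auto
qed

lemma nil_stab_perp:
  assumes "u \<in> nil_stab p F" and "i < p" and y: "y \<in> perp (F i)"
  shows "u y \<in> perp (F (Suc i))"
  using assms balt_adjoint[of u] unfolding perp_def nil_stab_def by fastforce

lemma perp_flag_top:
  assumes "singular_flag p F"
  shows "perp (F p) = F p"
proof -
  note F' = singular_flagD[OF assms]
  have "F p \<subseteq> perp (F p)" using F'(9) by (auto simp: perp_def)
  moreover have "dim (perp (F p)) = dim (F p)"
    using dim_perp_Rad[OF F'(6)[OF order_refl] F'(10)[OF F'(4) order_refl]] F'(5) F'(7)[of p] by simp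
  ultimately show ?thesis using subspace_dim_equal[OF F'(6)[OF order_refl] subspace_perp, of "F p"] by simp
qed

text \<open>Let s = dim Rad. In p - s steps u descends through the orthogonals from
  \<open>perp (F s)\<close>, which is V, to \<open>perp (F p)\<close> = \<open>F p\<close>; another
  p steps through the flag itself end at 0.\<close>

lemma nil_stab_nilpotent:
  assumes F: "singular_flag p F" and u: "u \<in> nil_stab p F"
  shows "nilpotent_endo u"
proof -
  note F' = singular_flagD[OF F]
  let ?s = "dim (Rad b)"
  have linu: "lin u" using u balt_lin by (simp add: nil_stab_def)
  have down: "i \<le> p \<Longrightarrow> x \<in> F i \<Longrightarrow> (u ^^ i) x = 0" for i x
  proof (induction i arbitrary: x)
    case 0
    then show ?case using F'(6,7)[of 0] by auto
  next
    case (Suc i)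
    then have "u x \<in> F i" using u by (auto simp: nil_stab_def Suc_le_eq)
    then show ?case using Suc by (simp add: funpow_swap1)
  qed
  have up: "j \<le> p - ?s \<Longrightarrow> (u ^^ j) x \<in> perp (F (?s + j))" for j x
  proof (induction j)
    case 0
    then show ?case using F'(3) perp_Rad by simp
  next
    case (Suc j)
    then show ?case using nil_stab_perp[OF u, of "?s + j" "(u ^^ j) x"] by simp
  qed
  have "(u ^^ (p + (p - ?s))) x = 0" for x
  proof -
    have "(u ^^ (p - ?s)) x \<in> F p" using up[of "p - ?s" x] F'(4) perp_flag_top[OF F] by simp
    then show ?thesis using down[of p] by (simp add: funpow_add)
  qed
  then show ?thesis unfolding nilpotent_endo_def by blast
qed

lemma nil_stab_eq:
  assumes F: "singular_flag p F"
  shows "nil_stab p F = {u. balt u \<and> nilpotent_endo u \<and> stabilizes_flag p F u}"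
proof -
  note F' = singular_flagD[OF F]
  show ?thesis
  proof (intro equalityI subsetI)
    fix u assume u: "u \<in> nil_stab p F"
    then show "u \<in> {u. balt u \<and> nilpotent_endo u \<and> stabilizes_flag p F u}"
      using nil_stab_nilpotent[OF F u] nil_stab_stabilizes[OF F'(1) u]
      by (auto simp: nil_stab_def stabilizes_flag_def)
  next
    fix u assume "u \<in> {u. balt u \<and> nilpotent_endo u \<and> stabilizes_flag p F u}"
    then show "u \<in> nil_stab p F"
      using nil_stab_of_nilpotent[OF F'(1), of u] by (auto simp: stabilizes_flag_def)
  qed
qed

end

section \<open>Dimension bound for the nilpotent stabilizer of a singular flag\<close>

lemma sum_lessThan_eq_choose_2: "(\<Sum>j<s. j) = s choose 2"
  by (induction s) (auto simp: numeral_2_eq_2)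

text \<open>As i < s, the disjunction amounts to i < j; it is split because the blocks j < s and s
  \<le> j are counted separately.\<close>

lemma card_index_pairs_le:
  "card {(i, j). i < s \<and> j < n \<and> (s \<le> j \<or> i < j)} \<le> (s choose 2) + s * (n - (s::nat))"
proof -
  let ?A = "(\<lambda>(j, i). (i, j)) ` (SIGMA j:{..<s}. {..<j})"
  let ?B = "{..<s} \<times> {s..<n}"
  have "{(i, j). i < s \<and> j < n \<and> (s \<le> j \<or> i < j)} \<subseteq> ?A \<union> ?B"
    by (auto simp: image_iff)
  then have "card {(i, j). i < s \<and> j < n \<and> (s \<le> j \<or> i < j)} \<le> card (?A \<union> ?B)"
    by (rule card_mono[rotated]) auto
  also have "\<dots> \<le> card ?A + card ?B" by (rule card_Un_le)
  also have "card ?A \<le> card (SIGMA j:{..<s}. {..<j})" by (rule card_image_le) auto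
  also have "card (SIGMA j:{..<s}. {..<j}) = s choose 2"
    by (simp add: sum_lessThan_eq_choose_2)
  finally show ?thesis by simp
qed

text \<open>The conditions force p \<le> j. For j = p + l the index i runs from p - l to p + l - 1,
  at most 2 l values, and 2 l summed over l < m is m (m - 1).\<close>

lemma card_hyperbolic_pairs_le:
  fixes p m :: nat
  shows "card {(i, j). i < j \<and> j < p + m \<and> 2 * p \<le> i + j} \<le> m * (m - 1)"
proof -
  let ?S = "SIGMA l:{..<m}. {p - l..<p + l}"
  have "{(i, j). i < j \<and> j < p + m \<and> 2 * p \<le> i + j} \<subseteq> (\<lambda>(l, i). (i, p + l)) ` ?S"
  proof (intro subsetI)
    fix x assume "x \<in> {(i, j). i < j \<and> j < p + m \<and> 2 * p \<le> i + j}"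
    then obtain i j where x: "x = (i, j)" "i < j" "j < p + m" "2 * p \<le> i + j" by auto
    then have "(j - p, i) \<in> ?S" "x = (\<lambda>(l, i). (i, p + l)) (j - p, i)" by auto
    then show "x \<in> (\<lambda>(l, i). (i, p + l)) ` ?S" by (rule rev_image_eqI)
  qed
  then have "card {(i, j). i < j \<and> j < p + m \<and> 2 * p \<le> i + j} \<le> card ((\<lambda>(l, i). (i, p + l)) ` ?S)"
    by (rule card_mono[rotated]) auto
  also have "\<dots> \<le> card ?S" by (rule card_image_le) auto
  also have "card ?S = (\<Sum>l<m. p + l - (p - l))" by simp
  also have "\<dots> \<le> (\<Sum>l<m. 2 * l)" by (rule sum_mono) auto
  also have "\<dots> = m * (m - 1)"
    by (induction m) (auto simp: algebra_simps)
  finally show ?thesis .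
qed

context alternating_space
begin

text \<open>Above p the terms are the orthogonals in reverse order,
  \<open>perp (F (2 * p - j))\<close>; for j = n the index is s = dim Rad, whose orthogonal is V.
  Hence H i and H j are orthogonal once i + j \<le> 2 p. For i < s the index 2 p - i exceeds n, but
  then H i lies in the radical.\<close>

lemma complete_flag_extension:
  assumes F: "singular_flag p F"
  shows "\<exists>H. partially_complete_flag scale (dim UNIV) H \<and> (\<forall>j\<le>p. H j = F j) \<and> H (dim UNIV) = UNIV
    \<and> (\<forall>u\<in>nil_stab p F. \<forall>j<dim UNIV. u ` H (Suc j) \<subseteq> H j)
    \<and> (\<forall>i\<le>dim UNIV. \<forall>j\<le>dim UNIV. i + j \<le> 2 * p \<longrightarrow> (\<forall>x\<in>H i. \<forall>y\<in>H j. b x y = 0))"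
proof -
  note F' = singular_flagD[OF F]
  let ?n = "dim UNIV" and ?s = "dim (Rad b)"
  have sn: "?s \<le> ?n" by (rule dim_subset) simp
  have pn: "p \<le> ?n" "?n \<le> 2 * p" using F'(5) sn by linarith+
  define H where "H j = (if j \<le> p then F j else perp (F (2 * p - j)))" for j
  have HF: "H j = F j" if "j \<le> p" for j using that by (simp add: H_def)
  have Hperp: "H j = perp (F (2 * p - j))" if "p \<le> j" for j
    using that perp_flag_top[OF F] by (cases "j = p") (auto simp: H_def)
  have dimH: "subspace (H j) \<and> dim (H j) = j" if j: "j \<le> ?n" for j
  proof (cases "j \<le> p")
    case True
    then show ?thesis using F'(6,7) HF by simp
  next
    case False
    let ?i = "2 * p - j"
    have i: "?i \<le> p" "?s \<le> ?i" using False j F'(5) by linarith+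
    have "dim (perp (F ?i)) + ?i = 2 * p"
      using dim_perp_Rad[OF F'(6)[OF i(1)] F'(10)[OF i(2,1)]] F'(5) F'(7)[OF i(1)] by simp
    then show ?thesis using False j pn Hperp[of j] by simp
  qed
  have step: "H j \<subseteq> H (Suc j)" if j: "j < ?n" for j
  proof (cases "j < p")
    case True
    then show ?thesis using F'(8)[of j "Suc j"] HF by simp
  next
    case False
    then have "F (2 * p - Suc j) \<subseteq> F (2 * p - j)" by (intro F'(8)) auto
    then show ?thesis using False Hperp perp_antimono by simp
  qed
  have pcf: "partially_complete_flag scale ?n H"
    using dimH step unfolding partially_complete_flag_def by blast
  have top: "H ?n = UNIV"
  proof -
    have "2 * p - ?n = ?s" using F'(5) by linarith
    then show ?thesis using Hperp[OF pn(1)] F'(3) perp_Rad by simp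
  qed
  have down: "u ` H (Suc j) \<subseteq> H j" if u: "u \<in> nil_stab p F" and j: "j < ?n" for u j
  proof (cases "j < p")
    case True
    then show ?thesis using u HF by (simp add: nil_stab_def)
  next
    case False
    have "2 * p - Suc j < p" "Suc (2 * p - Suc j) = 2 * p - j" using False j pn by linarith+
    then show ?thesis using nil_stab_perp[OF u, of "2 * p - Suc j"] False Hperp by auto
  qed
  have orth1: "b x y = 0" if i: "i \<le> p" and j: "j \<le> ?n" and ij: "i + j \<le> 2 * p" and x: "x \<in> H i" and y: "y \<in> H j"
    for i j x y
  proof (cases "i \<le> ?s")
    case True
    then have "x \<in> Rad b" using x HF[OF i] F'(11)[OF True] by auto
    then show ?thesis by (rule Rad_left)
  next
    case False
    have "2 * p - i \<le> ?n" using False F'(5) by linarith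
    moreover have "j \<le> 2 * p - i" using ij by linarith
    ultimately have "y \<in> H (2 * p - i)" using flag_subset[OF pcf, of j "2 * p - i"] y by blast
    then have "y \<in> perp (F i)" using Hperp[of "2 * p - i"] i by simp
    then show ?thesis using x HF[OF i] by (simp add: perp_def)
  qed
  have orth: "b x y = 0" if i: "i \<le> ?n" and j: "j \<le> ?n" and ij: "i + j \<le> 2 * p" and x: "x \<in> H i" and y: "y \<in> H j"
    for i j x y
  proof (cases "i \<le> p")
    case True
    then show ?thesis using orth1[OF _ j ij x y] by blast
  next
    case False
    then have "b y x = 0" using orth1[of j i y x] i ij x y by simp
    then show ?thesis using b_eq_0_sym by blast
  qed
  show ?thesis using pcf HF top down orth by (intro exI[of _ H]) blast
qed

text \<open>In a basis \<open>e\<close> adapted to the complete flag, \<open>u\<close> is determined by the radical coordinates of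
  the \<open>u (e j)\<close> and by the alternating form \<open>b (u x) y\<close>; the pairs of indices at which these are not
  forced to vanish are counted by the bound.\<close>

lemma dim_nil_stab_le:
  assumes F: "singular_flag p F"
  shows "E.dim (nil_stab p F) \<le> (dim (Rad b) choose 2) + dim (Rad b) * (dim UNIV - dim (Rad b))
    + (p - dim (Rad b)) * (p - dim (Rad b) - 1)"
proof -
  note F' = singular_flagD[OF F]
  let ?n = "dim UNIV" and ?s = "dim (Rad b)" and ?N = "nil_stab p F"
  have sn: "?s \<le> ?n" by (rule dim_subset) simp
  have n_eq: "?n = p + (p - ?s)" using F'(4,5) by linarith
  obtain H where H: "partially_complete_flag scale ?n H" and HF0: "\<forall>j\<le>p. H j = F j" and top: "H ?n = UNIV"
    and down0: "\<forall>u\<in>?N. \<forall>j<?n. u ` H (Suc j) \<subseteq> H j"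
    and orth0: "\<forall>i\<le>?n. \<forall>j\<le>?n. i + j \<le> 2 * p \<longrightarrow> (\<forall>x\<in>H i. \<forall>y\<in>H j. b x y = 0)"
    using complete_flag_extension[OF F] by (elim exE conjE) (rule that)
  have HF: "H j = F j" if "j \<le> p" for j using HF0 that by blast
  have down: "u ` H (Suc j) \<subseteq> H j" if "u \<in> ?N" "j < ?n" for u j using down0 that by blast
  have orth: "b x y = 0" if "i \<le> ?n" "j \<le> ?n" "i + j \<le> 2 * p" "x \<in> H i" "y \<in> H j" for i j x y
    using orth0 that by blast
  have dimH: "subspace (H j)" "dim (H j) = j" if "j \<le> ?n" for j
    using H that by (auto simp: partially_complete_flag_def)
  have stepH: "H j \<subseteq> H (Suc j)" if "j < ?n" for j
    using H that by (auto simp: partially_complete_flag_def)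
  have "\<exists>x. x \<in> H (Suc j) \<and> x \<notin> H j" if "j < ?n" for j
  proof -
    have "H j \<noteq> H (Suc j)" using dimH[of j] dimH[of "Suc j"] that by auto
    then show ?thesis using stepH[OF that] by blast
  qed
  \<comment> \<open>Numbering starts at 0: \<open>e j\<close> spans \<open>H (Suc j)\<close> modulo
    \<open>H j\<close>, so elements of \<open>?N\<close> send it into \<open>H j\<close>.\<close>
  then obtain e where e: "\<And>j. j < ?n \<Longrightarrow> e j \<in> H (Suc j)" "\<And>j. j < ?n \<Longrightarrow> e j \<notin> H j" by metis
  have decomp: "\<exists>c. y - c *s e j \<in> H j" if "j < ?n" "y \<in> H (Suc j)" for j y
    using insert_decompose[of "H j" "H (Suc j)" "e j" y] dimH[of j] dimH[of "Suc j"] stepH[of j] e[of j] that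
    by simp
  have spanning: "T = UNIV" if T: "subspace T" and eT: "\<And>j. j < ?n \<Longrightarrow> e j \<in> T" for T
  proof -
    have "k \<le> ?n \<Longrightarrow> H k \<subseteq> T" for k
    proof (induction k)
      case 0
      then show ?case using dimH[of 0] subspace_0[OF T] by auto
    next
      case (Suc k)
      show ?case
      proof
        fix y assume "y \<in> H (Suc k)"
        then obtain c where "y - c *s e k \<in> H k" using decomp[of k y] Suc.prems by auto
        then have "y - c *s e k \<in> T" "c *s e k \<in> T" using Suc eT[of k] subspace_scale[OF T] by auto
        then have "(y - c *s e k) + c *s e k \<in> T" using subspace_add[OF T] by blast
        then show "y \<in> T" by simp
      qed
    qed
    then show ?thesis using top by blast
  qed
  \<comment> \<open>Only triangular coordinates on the radical: the functional at i is 1 on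
    \<open>e i\<close> and kills \<open>F i\<close>, but may be nonzero on later \<open>e j\<close>.
    This is enough to show r = 0 by going down the flag.\<close>
  have "\<exists>\<phi> :: 'v \<Rightarrow> 'k. (\<forall>y z. \<phi> (y + z) = \<phi> y + \<phi> z) \<and> (\<forall>c y. \<phi> (c *s y) = c * \<phi> y)
      \<and> \<phi> (e i) = 1 \<and> (\<forall>y\<in>F i. \<phi> y = 0)" if "i < ?s" for i
    using separating_functional[OF F'(6), of i "e i"] e(2)[of i] HF[of i] that F'(4) sn by simp
  then obtain \<phi> :: "nat \<Rightarrow> 'v \<Rightarrow> 'k" where
    \<phi>: "\<And>i. i < ?s \<Longrightarrow> (\<forall>y z. \<phi> i (y + z) = \<phi> i y + \<phi> i z) \<and> (\<forall>c y. \<phi> i (c *s y) = c * \<phi> i y)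
      \<and> \<phi> i (e i) = 1 \<and> (\<forall>y\<in>F i. \<phi> i y = 0)"
    by metis
  have sep: "r = 0" if r: "r \<in> Rad b" and r0: "\<And>i. i < ?s \<Longrightarrow> \<phi> i r = 0" for r
  proof -
    have "k \<le> ?s \<Longrightarrow> r \<in> F k \<Longrightarrow> r = 0" for k
    proof (induction k)
      case 0
      then show ?case using F'(6,7)[of 0] by auto
    next
      case (Suc k)
      have k: "k < ?n" "k < ?s" "Suc k \<le> p" using Suc.prems sn F'(4) by auto
      obtain c where c: "r - c *s e k \<in> F k" using decomp[of k r] HF[of k] HF[of "Suc k"] k Suc.prems by auto
      have "\<phi> k r = \<phi> k (r - c *s e k) + c"
        using conjunct1[OF \<phi>[OF k(2)], rule_format, of "r - c *s e k" "c *s e k"] \<phi>[OF k(2)] by simp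
      then have "c = 0" using \<phi>[OF k(2)] c r0[OF k(2)] by simp
      then show ?case using Suc c by simp
    qed
    then show ?thesis using r F'(3) by blast
  qed
  \<comment> \<open>\<open>Ia\<close> indexes the radical coordinates of u (e j); those with j \<le>
    i vanish because u (e j) lies in \<open>F j\<close>, hence in \<open>F i\<close>.
    \<open>Ib\<close> indexes the entries b(u (e i), e j) with i < j that orthogonality does not
    force to be zero.\<close>
  define Ia where "Ia = {(i, j). i < ?s \<and> j < ?n \<and> (?s \<le> j \<or> i < j)}"
  define Ib where "Ib = {(i, j). i < j \<and> j < p + (p - ?s) \<and> 2 * p \<le> i + j}"
  define I where "I = Inl ` Ia \<union> Inr ` Ib"
  define f where "f = case_sum (\<lambda>(i, j) u. \<phi> i (u (e j))) (\<lambda>(i, j) u. b (u (e i)) (e j))"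
  have finab: "finite Ia" "finite Ib"
    by (rule finite_subset[of _ "{..<?s} \<times> {..<?n}"], auto simp: Ia_def)
      (rule finite_subset[of _ "{..<2 * p} \<times> {..<2 * p}"], auto simp: Ib_def)
  have cardI: "card I \<le> (?s choose 2) + ?s * (?n - ?s) + (p - ?s) * (p - ?s - 1)"
  proof -
    have "card I \<le> card Ia + card Ib"
      unfolding I_def by (rule order_trans[OF card_Un_le add_mono[OF card_image_le card_image_le]]) (use finab in auto)
    then show ?thesis
      using card_index_pairs_le[of ?s ?n] card_hyperbolic_pairs_le[of p "p - ?s"]
      unfolding Ia_def Ib_def by linarith
  qed
  have N: "E.subspace ?N" by (rule subspace_nil_stab[OF F'(1)])
  have fdN: "fin_dim (fun_scale scale) ?N"
    by (rule E.fin_dim_subset[OF fin_dim_lin]) (auto simp: nil_stab_def balt_lin)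
  have "E.dim ?N \<le> card I + E.dim {u \<in> ?N. \<forall>i\<in>I. f i u = 0}"
  proof (rule conjunct2[OF E.dim_le_card_plus_dim_kernel[OF _ N fdN]])
    show "finite I" using finab by (simp add: I_def)
    fix t u v c assume t: "t \<in> I"
    show "f t (u + v) = f t u + f t v" "f t (fun_scale scale c u) = c * f t u"
      using t \<phi> by (auto simp: I_def f_def Ia_def fun_scale_def b_add_left b_scale_left)
  qed
  also have "{u \<in> ?N. \<forall>i\<in>I. f i u = 0} \<subseteq> {0}"
  proof
    fix u assume "u \<in> {u \<in> ?N. \<forall>i\<in>I. f i u = 0}"
    then have u: "u \<in> ?N" and f0: "\<And>t. t \<in> I \<Longrightarrow> f t u = 0" by auto
    have bu: "balt u" using u by (simp add: nil_stab_def)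
    have ue: "u (e j) \<in> H j" if "j < ?n" for j using down[OF u that] e(1)[OF that] by blast
    have lt: "b (u (e i)) (e j) = 0" if ij: "i < j" "j < ?n" for i j
    proof (cases "2 * p \<le> i + j")
      case True
      then have "(i, j) \<in> Ib" using ij n_eq by (simp add: Ib_def)
      then show ?thesis using f0[of "Inr (i, j)"] by (simp add: I_def f_def)
    next
      case False
      \<comment> \<open>Since u (e i) lies in \<open>H i\<close> and \<open>e j\<close> in
        \<open>H (Suc j)\<close>, the strict inequality i + j < 2 p is exactly what orthogonality
        requires.\<close>
      then show ?thesis using orth[of i "Suc j" "u (e i)" "e j"] ue[of i] e(1)[of j] ij by simp
    qed
    have all: "b (u (e i)) (e j) = 0" if ij: "i < ?n" "j < ?n" for i j
    proof (cases i j rule: linorder_cases)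
      case less
      then show ?thesis using lt ij by blast
    next
      case equal
      then show ?thesis using bu b_eq_0_sym[of "u (e i)" "e i"] by (simp add: b_alternating_def)
    next
      case greater
      then have "b (u (e j)) (e i) = 0" using lt ij by blast
      then show ?thesis using balt_adjoint[OF bu, of "e i" "e j"] b_eq_0_sym by metis
    qed
    have uR: "u (e i) \<in> Rad b" if i: "i < ?n" for i
    proof -
      have "perp {u (e i)} = UNIV" by (rule spanning[OF subspace_perp]) (use all i in \<open>auto simp: perp_def\<close>)
      then show ?thesis using b_eq_0_sym by (auto simp: perp_def Rad_def)
    qed
    have u0: "u (e j) = 0" if j: "j < ?n" for j
    proof (rule sep[OF uR[OF j]])
      fix i assume i: "i < ?s"
      show "\<phi> i (u (e j)) = 0"
      proof (cases "?s \<le> j \<or> i < j")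
        case True
        then have "(i, j) \<in> Ia" using i j by (simp add: Ia_def)
        then show ?thesis using f0[of "Inl (i, j)"] by (simp add: I_def f_def)
      next
        case False
        then have "u (e j) \<in> F i" using ue[OF j] HF[of j] F'(8)[of j i] i F'(4) by auto
        then show ?thesis using \<phi>[OF i] by blast
      qed
    qed
    have "{x. u x = 0} = UNIV"
    proof (rule spanning)
      show "subspace {x. u x = 0}"
        using balt_lin[OF bu] unfolding subspace_def by (simp add: lin_add lin_scale lin_0)
    qed (use u0 in simp)
    then show "u \<in> {0}" by (auto simp: fun_eq_iff)
  qed
  then have "E.dim {u \<in> ?N. \<forall>i\<in>I. f i u = 0} \<le> card ({} :: ('v \<Rightarrow> 'v) set)"
    by (intro E.dim_le_card) auto
  finally show ?thesis using cardI by simp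
qed

end

section \<open>Extremal spaces of nilpotent alternating endomorphisms\<close>

context alternating_space
begin

text \<open>The trace form pairs \<open>V\<close> with \<open>nil_stab p F\<close>, where \<open>F\<close> is a flag adapted to \<open>v\<close>. As \<open>V\<close> is
  totally isotropic and at least as large as \<open>nil_stab p F\<close>, each element of the latter that is
  orthogonal to \<open>V\<close> lies in \<open>V\<close>; one such element is \<open>v\<^sup>2\<close>.\<close>

lemma square_mem_of_large:
  assumes V: "E.subspace V" and balt: "\<And>u. u \<in> V \<Longrightarrow> balt u"
    and nil: "\<And>u. u \<in> V \<Longrightarrow> nilpotent_endo u"
    and large: "\<And>p F. singular_flag p F \<Longrightarrow> E.dim (nil_stab p F) \<le> E.dim V"
    and v: "v \<in> V"
  shows "(\<lambda>x. v (v x)) \<in> V"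
proof -
  note linV = balt_lin[OF balt]
  have fdV: "fin_dim (fun_scale scale) V"
    by (rule E.fin_dim_subset[OF fin_dim_lin]) (use linV in auto)
  have tr0: "tr (\<lambda>x. w (u x)) = 0" "tr (\<lambda>x. w (w (u x))) = 0" if "u \<in> V" "w \<in> V" for u w
    using tr_mult_nilpotent[OF char linV[OF that(2)] linV[OF that(1)]] nil that
      E.subspace_add[OF V that(2,1)] E.subspace_diff[OF V that(2,1)] by blast+
  obtain p F where F: "singular_flag p F" and vF: "{v} \<subseteq> nil_stab p F"
    using singular_flag_exists[OF triang_singleton[OF linV[OF v] nil[OF v]]] balt[OF v] by blast
  note F' = singular_flagD[OF F]
  let ?N = "nil_stab p F"
  have N: "E.subspace ?N" by (rule subspace_nil_stab[OF F'(1)])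
  have fdN: "fin_dim (fun_scale scale) ?N"
    by (rule E.fin_dim_subset[OF fin_dim_lin]) (auto simp: nil_stab_def balt_lin)
  have linN: "lin z" if "z \<in> ?N" for z using that balt_lin by (simp add: nil_stab_def)
  let ?\<beta> = "\<lambda>(u::'v \<Rightarrow> 'v) (z::'v \<Rightarrow> 'v). tr (\<lambda>x. z (u x))"
  let ?L = "{u \<in> V. \<forall>z\<in>?N. ?\<beta> u z = 0}" and ?R = "{z \<in> ?N. \<forall>u\<in>V. ?\<beta> u z = 0}"
  have addl: "?\<beta> (u + w) z = ?\<beta> u z + ?\<beta> w z" if "z \<in> ?N" for u w z
    using tr_add[of "\<lambda>x. z (u x)" "\<lambda>x. z (w x)"] lin_add[OF linN[OF that]] by (simp add: plus_fun_def)
  have scll: "?\<beta> (fun_scale scale c u) z = c * ?\<beta> u z" if "z \<in> ?N" for c u z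
    using tr_scale[of c "\<lambda>x. z (u x)"] lin_scale[OF linN[OF that]] by (simp add: fun_scale_def)
  have addr: "?\<beta> u (z + w) = ?\<beta> u z + ?\<beta> u w" for u z w
    using tr_add[of "\<lambda>x. z (u x)" "\<lambda>x. w (u x)"] by (simp add: plus_fun_def)
  have sclr: "?\<beta> u (fun_scale scale c z) = c * ?\<beta> u z" for c u z
    using tr_scale[of c "\<lambda>x. z (u x)"] by (simp add: fun_scale_def)
  have vsE: "vector_space (fun_scale scale)" by unfold_locales
  \<comment> \<open>In other words dim V - dim L \<le> dim N - dim R for the one-sided kernels L and
    R. With dim N \<le> dim V this gives dim R \<le> dim L, and the isotropy of V supplies the
    inclusion of L in R.\<close>
  have "E.dim V + E.dim ?R \<le> E.dim ?N + E.dim ?L"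
    by (rule pairing_dim_le[OF vsE vsE V fdV N fdN]) (simp_all only: addl scll addr sclr)
  then have dimRL: "E.dim ?R \<le> E.dim ?L" using large[OF F] by simp
  have LN: "?L \<subseteq> ?N"
  proof
    fix u assume u: "u \<in> ?L"
    show "u \<in> ?N"
      by (rule nil_stab_of_nilpotent[OF F'(1)])
        (use u balt nil stabilizes_of_trace[OF F, of u] in auto)
  qed
  have LR: "?L \<subseteq> ?R" using LN tr0(1) by blast
  have z0: "?\<beta> u 0 = 0" for u using sclr[of 0 u 0] by (simp add: tr_def representation_zero)
  have u0: "?\<beta> 0 z = 0" if "z \<in> ?N" for z using lin_0[OF linN[OF that]] by (simp add: tr_def representation_zero)
  have R: "E.subspace ?R"
    using N unfolding E.subspace_def by (simp add: z0 addr sclr del: plus_fun_apply zero_fun_apply)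
  have L: "E.subspace ?L"
    using V unfolding E.subspace_def by (simp add: u0 addl scll del: plus_fun_apply zero_fun_apply)
  have "?L = ?R"
    by (rule E.subspace_eq_of_dim_le[OF R E.fin_dim_subset[OF fdN] L LR dimRL]) auto
  moreover have "(\<lambda>x. v (v x)) \<in> ?R"
  proof -
    have v': "v \<in> ?N" using vF by simp
    have "balt (\<lambda>x. v (v x))"
      using balt_adjoint[OF balt[OF v]] linV[OF v] by (simp add: b_alternating_def lin_iff)
    moreover have "v (v x) \<in> F i" if "i < p" "x \<in> F (Suc i)" for i x
    proof -
      have "v x \<in> F i" using v' that by (auto simp: nil_stab_def)
      then show ?thesis using nil_stab_stabilizes[OF F'(1) v', of i] that by simp
    qed
    ultimately have "(\<lambda>x. v (v x)) \<in> ?N" unfolding nil_stab_def by blast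
    \<comment> \<open>The square of v is not yet known to lie in V, so its orthogonality to V needs
      the second trace identity.\<close>
    then show ?thesis using tr0(2)[OF _ v] by simp
  qed
  ultimately show ?thesis by blast
qed

text \<open>The assumption \<open>large\<close> ranges over all singular flags because the flag used
  for a square depends on the element squared, and the final flag depends on V.\<close>

theorem large_nilpotent_space_eq_nil_stab:
  assumes V: "E.subspace V" and balt: "\<And>u. u \<in> V \<Longrightarrow> balt u"
    and nil: "\<And>u. u \<in> V \<Longrightarrow> nilpotent_endo u"
    and large: "\<And>p F. singular_flag p F \<Longrightarrow> E.dim (nil_stab p F) \<le> E.dim V"
  shows "\<exists>p F. singular_flag p F \<and> V = nil_stab p F"
proof -
  have "triang V"
    by (rule triang_Jordan_closed[OF V balt_lin[OF balt] nil square_mem_of_large[OF assms]])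
  then obtain p F where F: "singular_flag p F" and sub: "V \<subseteq> nil_stab p F"
    using singular_flag_exists[OF _ balt] by blast
  have "fin_dim (fun_scale scale) (nil_stab p F)"
    by (rule E.fin_dim_subset[OF fin_dim_lin]) (auto simp: nil_stab_def balt_lin)
  then have "V = nil_stab p F"
    using E.subspace_eq_of_dim_le[OF subspace_nil_stab[OF singular_flagD(1)[OF F]] _ V sub large[OF F]]
    by blast
  then show ?thesis using F by blast
qed

end

theorem mainTheorem6:
  fixes scale :: "'k::field \<Rightarrow> 'v::ab_group_add \<Rightarrow> 'v"
    and Basis :: "'v set"
    and b :: "'v \<Rightarrow> 'v \<Rightarrow> 'k"
    and \<V> :: "('v \<Rightarrow> 'v) set"
    and n r \<nu> :: nat
  assumes fdvs: "finite_dimensional_vector_space scale Basis"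
    and char: "(2::'k) \<noteq> 0"
    and n_def: "n = vector_space.dim scale (UNIV::'v set)"
    and bil: "bilinear_form scale b"
    and alt: "alternating_form b"
    and nu_def: "\<nu> = witt_index scale b"
    and r_def: "r = form_rank scale b"
    and sub: "module.subspace (fun_scale scale) \<V>"
    and inA: "\<forall>u\<in>\<V>. b_alternating scale b u"
    and nil: "\<forall>u\<in>\<V>. nilpotent_endo u"
    and dimV: "int (vector_space.dim (fun_scale scale) \<V>)
               = int ((n - r) choose 2) + int r * int (n - r)
                 + (int \<nu> - int n + int r) * (int n - int \<nu> - 1)"
  shows "\<exists>F. partially_complete_flag scale \<nu> F \<and> totally_singular b (F \<nu>) \<and>
             F (n - r) = Rad b \<and>
             \<V> = {u. b_alternating scale b u \<and> nilpotent_endo u \<and> stabilizes_flag \<nu> F u}"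
proof -
  interpret finite_dimensional_vector_space scale Basis by (rule fdvs)
  interpret alternating_space scale Basis b
    by unfold_locales (use bil alt char in auto)
  let ?s = "dim (Rad b)"
  have sn: "?s \<le> n" unfolding n_def by (rule dim_subset) simp
  have nr: "n - r = ?s" using sn by (simp add: r_def form_rank_def n_def)
  have rs: "r = n - ?s" by (simp add: r_def form_rank_def n_def)
  have large: "E.dim (nil_stab p F) \<le> E.dim \<V>" if F: "singular_flag p F" for p F
  proof -
    have p: "p = \<nu>" using witt_index_eq[OF F] nu_def by simp
    have nu: "?s \<le> \<nu>" "2 * \<nu> = n + ?s" using singular_flagD(4,5)[OF F] p n_def by simp_all
    have "int (E.dim (nil_stab p F)) \<le>
        int ((?s choose 2) + ?s * (n - ?s) + (\<nu> - ?s) * (\<nu> - ?s - 1))"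
      using dim_nil_stab_le[OF F] unfolding p n_def by (simp only: of_nat_le_iff)
    also have "\<dots> = int (?s choose 2) + int r * int ?s + int (\<nu> - ?s) * int (\<nu> - ?s - 1)"
      by (simp add: rs mult.commute)
    \<comment> \<open>Both factors agree because \<nu> - s = n - \<nu>, where s = dim Rad. The case
      \<nu> = s is treated apart: natural subtraction gives 0 where the integer factor is -1, but
      the other factor vanishes there.\<close>
    also have "int (\<nu> - ?s) * int (\<nu> - ?s - 1) = (int \<nu> - int n + int r) * (int n - int \<nu> - 1)"
    proof (cases "\<nu> = ?s")
      case True
      then show ?thesis using nu rs by simp
    next
      case False
      have "int (\<nu> - ?s) = int \<nu> - int n + int r" using nu rs sn by simp
      moreover have "int (\<nu> - ?s - 1) = int n - int \<nu> - 1" using nu False by linarith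
      ultimately show ?thesis by simp
    qed
    finally show ?thesis using dimV nr by simp
  qed
  obtain p F where F: "singular_flag p F" and eq: "\<V> = nil_stab p F"
    using large_nilpotent_space_eq_nil_stab[OF sub _ _ large] inA nil by blast
  have p: "p = \<nu>" using witt_index_eq[OF F] nu_def by simp
  show ?thesis
    using singular_flagD(1-3)[OF F] nil_stab_eq[OF F] eq unfolding p nr by blast
qed

end
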